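(* Let $U:\mathbb{R}^d\to\mathbb{R}$ be in $\mathcal{C}^4(\mathbb{R}^d)$ with $\int e^{-U(x)}dx<\infty$, having a global minimum at $0$ with $U(0)=0$, and such that $L:=\sup\|D^2U\|<\infty$, $L_H:=\sup\|D^3U\|<\infty$, $L_I:=\sup\|D^4U\|<\infty$. Let $T>0$ and $h>0$ satisfy $T/h\in\mathbb{N}$ and $L(T^2+Th)\le 1/6$. Let $\tilde\pi$ be the transition kernel of unadjusted Hamiltonian Monte Carlo with duration $T$ and step size $h$. Suppose that there is an invariant probability measure $\tilde\mu$ of $\tilde\pi$ such that (A5) there exist constants $M_1,c\in(0,\infty)$ such that for any $m\in\mathbb{N}_0$ and any probability measure $\nu$ on $\mathbb{R}^d$, $W^1(\nu\tilde\pi^m,\tilde\mu)\le M_1e^{-cm}W^1(\nu,\tilde\mu)$; (A6) there exists a constant $M_2\in(0,\infty)$ such that $W^1(\mu,\tilde\mu)\le M_2h^2$. Then for any $m\in\mathbb{N}_0$ and any probability measure $\nu$ on $\mathbb{R}^d$, $$\mathrm{TV}(\tilde\mu,\nu\tilde\pi^{m+1})\ \le\ \tfrac32\left(T^{-2}+27\,d\,L_H^2\,T^4\right)^{1/2}M_1\,W^1(\tilde\mu,\nu)\,e^{-cm}.$$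
   Context: $|\cdot|$ is the Euclidean norm and $\|\cdot\|$ the operator norm of a multilinear form (supremum over unit vectors in each argument). The target measure is $\mu(dx)=Z^{-1}e^{-U(x)}dx$, $Z=\int e^{-U(x)}dx$. Velocity Verlet: for $h>0$ let $\lfloor t\rfloor_h=\max\{s\in h\mathbb{Z}:s\le t\}$ and $\lceil t\rceil_h=\min\{s\in h\mathbb{Z}:s\ge t\}$. For $(x,v)\in\mathbb{R}^{2d}$, $(\tilde q_t(x,v),\tilde v_t(x,v))_{t\ge0}$ is the continuous, piecewise differentiable solution of $$\tfrac{d}{dt}\tilde q_t=\tilde v_{\lfloor t\rfloor_h}-(t-\lfloor t\rfloor_h)\nabla U(\tilde q_{\lfloor t\rfloor_h}),\qquad \tfrac{d}{dt}\tilde v_t=-\tfrac12\left(\nabla U(\tilde q_{\lfloor t\rfloor_h})+\nabla U(\tilde q_{\lceil t\rceil_h})\right)$$ with $(\tilde q_0,\tilde v_0)=(x,v)$. Equivalently, on the grid $t_k=kh$: $\tilde q_{t_{k+1}}=\tilde q_{t_k}+h\tilde v_{t_k}-\frac{h^2}{2}\nabla U(\tilde q_{t_k})$ and $\tilde v_{t_{k+1}}=\tilde v_{t_k}-\frac h2[\nabla U(\tilde q_{t_k})+\nabla U(\tilde q_{t_{k+1}})]$. The unadjusted HMC (uHMC) kernel with duration $T$ and step size $h$ is $\tilde\pi(x,A)=P[\tilde q_T(x,\xi)\in A]$ with $\xi\sim\mathcal N(0,I_d)$. For a probability measure $\nu$, $\nu\tilde\pi(A)=\int\nu(dx)\tilde\pi(x,A)$,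 and $\tilde\pi^m$ is the $m$-fold composition ($\tilde\pi^0$ is the identity). $\mathrm{TV}(\nu,\eta)=\sup_A|\nu(A)-\eta(A)|$ over Borel sets $A$. $W^1(\nu,\eta)=\inf E[|X-Y|]$ over all couplings $(X,Y)$ of $\nu,\eta$ (possibly $+\infty$). *)

theory Defs
  imports "HOL-Probability.Probability"
begin

definition fderiv :: "('a::real_normed_vector \<Rightarrow> 'b::real_normed_vector) \<Rightarrow> 'a \<Rightarrow> 'a \<Rightarrow>\<^sub>L 'b" where
  "fderiv f x = Blinfun (frechet_derivative f (at x))"

text \<open>
  The \<open>k\<close>-th derivative \<open>D\<^sup>kU\<close> is the \<open>k\<close>-fold iterate of \<^const>\<open>fderiv\<close>, a \<open>k\<close>-linear form in
  curried shape. Its norm as a nested bounded linear map is the supremum of the values over unit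
  vectors in each argument, by iterating \<open>norm_blinfun_eq_SUP_sphere\<close>.
\<close>

definition D2 :: "('a::real_normed_vector \<Rightarrow> real) \<Rightarrow> 'a \<Rightarrow> 'a \<Rightarrow>\<^sub>L 'a \<Rightarrow>\<^sub>L real" where
  "D2 U = fderiv (fderiv U)"

definition D3 :: "('a::real_normed_vector \<Rightarrow> real) \<Rightarrow> 'a \<Rightarrow> 'a \<Rightarrow>\<^sub>L 'a \<Rightarrow>\<^sub>L 'a \<Rightarrow>\<^sub>L real" where
  "D3 U = fderiv (D2 U)"

definition D4 :: "('a::real_normed_vector \<Rightarrow> real) \<Rightarrow> 'a \<Rightarrow> 'a \<Rightarrow>\<^sub>L 'a \<Rightarrow>\<^sub>L 'a \<Rightarrow>\<^sub>L 'a \<Rightarrow>\<^sub>L real" where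
  "D4 U = fderiv (D3 U)"

definition C4 :: "('a::real_normed_vector \<Rightarrow> real) \<Rightarrow> bool" where
  "C4 U \<longleftrightarrow> (\<forall>x. U differentiable (at x)) \<and> (\<forall>x. fderiv U differentiable (at x)) \<and>
     (\<forall>x. D2 U differentiable (at x)) \<and> (\<forall>x. D3 U differentiable (at x)) \<and>
     continuous_on UNIV (D4 U)"

lemma blinfun_apply_fderiv:
  assumes "f differentiable (at x)"
  shows "(f has_derivative blinfun_apply (fderiv f x)) (at x)"
proof -
  have d: "(f has_derivative frechet_derivative f (at x)) (at x)"
    using assms frechet_derivative_works by blast
  then have "bounded_linear (frechet_derivative f (at x))"
    by (rule has_derivative_bounded_linear)
  with d show ?thesis
    unfolding fderiv_def by (simp add: bounded_linear_Blinfun_apply)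
qed

lemma norm_blinfun_eq_SUP_sphere:
  fixes A :: "'a::euclidean_space \<Rightarrow>\<^sub>L 'b::real_normed_vector"
  shows "norm A = (SUP u\<in>sphere 0 1. norm (blinfun_apply A u))"
proof (rule antisym)
  have le: "norm (blinfun_apply A u) \<le> norm A" if "norm u = 1" for u
    using norm_blinfun[of A u] that by simp
  have bdd: "bdd_above ((\<lambda>u. norm (blinfun_apply A u)) ` sphere 0 1)"
    by (rule bdd_aboveI2[where M = "norm A"]) (metis le mem_sphere_0)
  have "norm (blinfun_apply A x) \<le> (SUP u\<in>sphere 0 1. norm (blinfun_apply A u)) * norm x" for x
  proof (cases "x = 0")
    case False
    then have "x /\<^sub>R norm x \<in> sphere 0 1" by simp
    from cSUP_upper[OF this bdd] have
      "norm (blinfun_apply A (x /\<^sub>R norm x)) \<le> (SUP u\<in>sphere 0 1. norm (blinfun_apply A u))" .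
    with False show ?thesis
      by (simp add: blinfun.scaleR_right field_simps)
  qed simp
  moreover have "0 \<le> (SUP u\<in>sphere 0 1. norm (blinfun_apply A u))"
  proof -
    obtain b :: 'a where "b \<in> Basis" using nonempty_Basis by blast
    then have "b \<in> sphere 0 1" by simp
    from cSUP_upper[OF this bdd] show ?thesis
      using norm_ge_zero order_trans by blast
  qed
  ultimately show "norm A \<le> (SUP u\<in>sphere 0 1. norm (blinfun_apply A u))"
    by (intro norm_blinfun_bound) auto
  show "(SUP u\<in>sphere 0 1. norm (blinfun_apply A u)) \<le> norm A"
  proof (rule cSUP_least)
    show "sphere (0::'a) 1 \<noteq> {}" by simp
  qed (metis le mem_sphere_0)
qed

definition grad :: "('a::real_inner \<Rightarrow> real) \<Rightarrow> 'a \<Rightarrow> 'a" where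
  "grad U x = (THE g. GDERIV U x :> g)"

definition verlet_step :: "('a::real_inner \<Rightarrow> real) \<Rightarrow> real \<Rightarrow> 'a \<times> 'a \<Rightarrow> 'a \<times> 'a" where
  "verlet_step U h = (\<lambda>(q, v).
     let q' = q + h *\<^sub>R v - (h\<^sup>2 / 2) *\<^sub>R grad U q
     in (q', v - (h / 2) *\<^sub>R (grad U q + grad U q')))"

text \<open>
  Position of velocity Verlet at the grid time \<open>t\<close>, an integer multiple of \<open>h\<close>.
\<close>

definition verlet_pos :: "('a::real_inner \<Rightarrow> real) \<Rightarrow> real \<Rightarrow> real \<Rightarrow> 'a \<Rightarrow> 'a \<Rightarrow> 'a" where
  "verlet_pos U h t x v = fst ((verlet_step U h ^^ nat \<lfloor>t / h\<rfloor>) (x, v))"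

text \<open>
  The grid recursion agrees with the continuous, piecewise differentiable solution of the velocity
  Verlet differential equation; \<open>h * \<lfloor>t / h\<rfloor>\<close> and \<open>h * \<lceil>t / h\<rceil>\<close> are the grid points next to \<open>t\<close>.
\<close>

lemma verlet_ode_grid:
  fixes U :: "'a::euclidean_space \<Rightarrow> real" and q w :: "real \<Rightarrow> 'a" and h :: real
  assumes h: "h > 0"
    and init: "q 0 = x" "w 0 = v"
    and cont: "continuous_on {0..} q" "continuous_on {0..} w"
    and q_ode: "\<And>t. t > 0 \<Longrightarrow> t / h \<notin> \<int> \<Longrightarrow>
      (q has_vector_derivative
        w (h * \<lfloor>t / h\<rfloor>) - (t - h * \<lfloor>t / h\<rfloor>) *\<^sub>R grad U (q (h * \<lfloor>t / h\<rfloor>))) (at t)"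
    and w_ode: "\<And>t. t > 0 \<Longrightarrow> t / h \<notin> \<int> \<Longrightarrow>
      (w has_vector_derivative
        - (1 / 2) *\<^sub>R (grad U (q (h * \<lfloor>t / h\<rfloor>)) + grad U (q (h * \<lceil>t / h\<rceil>)))) (at t)"
  shows "(q (real k * h), w (real k * h)) = (verlet_step U h ^^ k) (x, v)"
proof (induction k)
  case 0
  show ?case using init by simp
next
  case (Suc k)
  define a where "a = real k * h"
  define b where "b = real (Suc k) * h"
  have ab: "0 \<le> a" "a < b" "b = a + h"
    using h by (auto simp: a_def b_def algebra_simps)
  have inner: "t > 0" "t / h \<notin> \<int>" "h * \<lfloor>t / h\<rfloor> = a" "h * \<lceil>t / h\<rceil> = b" if t: "a < t" "t < b" for t
  proof -
    show "t > 0" using t ab by linarith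
    have 1: "real k < t / h" "t / h < real k + 1"
      using t h by (auto simp: a_def b_def field_simps)
    then have fl: "\<lfloor>t / h\<rfloor> = int k" and ce: "\<lceil>t / h\<rceil> = int k + 1"
      by (auto simp: floor_eq_iff ceiling_eq_iff)
    show "t / h \<notin> \<int>"
    proof
      assume "t / h \<in> \<int>"
      then obtain j :: int where j: "t / h = of_int j" by (auto elim: Ints_cases)
      have "j = int k" using fl unfolding j by simp
      with 1 j show False by simp
    qed
    show "h * \<lfloor>t / h\<rfloor> = a" "h * \<lceil>t / h\<rceil> = b"
      by (simp_all add: fl ce a_def b_def algebra_simps)
  qed
  have sub: "{a..b} \<subseteq> {0..}" using ab by auto
  have cq: "continuous_on {a..b} q" and cw: "continuous_on {a..b} w"
    using cont sub continuous_on_subset by blast+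
  define gq where "gq = (\<lambda>t. q t - (t - a) *\<^sub>R w a + ((t - a)\<^sup>2 / 2) *\<^sub>R grad U (q a))"
  define gw where "gw = (\<lambda>t. w t + ((t - a) / 2) *\<^sub>R (grad U (q a) + grad U (q b)))"
  have "gq b = q a"
  proof (rule has_derivative_zero_unique_strong_interval[of "{a, b}" a b gq "q a" b])
    show "continuous_on {a..b} gq"
      unfolding gq_def by (intro continuous_intros cq) simp_all
    fix t assume "t \<in> {a..b} - {a, b}"
    then have t: "a < t" "t < b" by auto
    have dq: "(q has_vector_derivative w a - (t - a) *\<^sub>R grad U (q a)) (at t within {a..b})"
      using q_ode[OF inner(1,2)[OF t]] inner(3)[OF t] by (simp add: has_vector_derivative_at_within)
    have p1: "((\<lambda>t. t - a) has_real_derivative 1) (at t within {a..b})"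
      by (auto intro!: derivative_eq_intros)
    have p2: "((\<lambda>t. (t - a)\<^sup>2 / 2) has_real_derivative t - a) (at t within {a..b})"
      by (auto intro!: derivative_eq_intros)
    have "(gq has_vector_derivative 0) (at t within {a..b})"
      unfolding gq_def
      using has_vector_derivative_add[OF has_vector_derivative_diff[OF dq
          has_vector_derivative_scaleR[OF p1 has_vector_derivative_const[of "w a"]]]
          has_vector_derivative_scaleR[OF p2 has_vector_derivative_const[of "grad U (q a)"]]]
      by simp
    then show "(gq has_derivative (\<lambda>h. 0)) (at t within {a..b})"
      by (simp add: has_vector_derivative_def)
  qed (use ab in \<open>auto simp: gq_def\<close>)
  then have qb: "q b = q a + h *\<^sub>R w a - (h\<^sup>2 / 2) *\<^sub>R grad U (q a)"
    by (simp add: gq_def ab(3) algebra_simps)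
  have "gw b = w a"
  proof (rule has_derivative_zero_unique_strong_interval[of "{a, b}" a b gw "w a" b])
    show "continuous_on {a..b} gw"
      unfolding gw_def by (intro continuous_intros cw) simp_all
    fix t assume "t \<in> {a..b} - {a, b}"
    then have t: "a < t" "t < b" by auto
    have dw: "(w has_vector_derivative - (1 / 2) *\<^sub>R (grad U (q a) + grad U (q b))) (at t within {a..b})"
      using w_ode[OF inner(1,2)[OF t]] inner(3,4)[OF t] by (metis has_vector_derivative_at_within)
    have p: "((\<lambda>t. (t - a) / 2) has_real_derivative 1 / 2) (at t within {a..b})"
      by (auto intro!: derivative_eq_intros)
    have "(gw has_vector_derivative 0) (at t within {a..b})"
      unfolding gw_def
      using has_vector_derivative_add[OF dw
          has_vector_derivative_scaleR[OF p has_vector_derivative_const[of "grad U (q a) + grad U (q b)"]]]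
      by simp
    then show "(gw has_derivative (\<lambda>h. 0)) (at t within {a..b})"
      by (simp add: has_vector_derivative_def)
  qed (use ab in \<open>auto simp: gw_def\<close>)
  then have wb: "w b = w a - (h / 2) *\<^sub>R (grad U (q a) + grad U (q b))"
    by (simp add: gw_def ab(3) algebra_simps)
  have "(verlet_step U h ^^ Suc k) (x, v) = verlet_step U h (q a, w a)"
    using Suc.IH by (simp add: a_def)
  also have "\<dots> = (q b, w b)"
    using qb wb by (simp add: verlet_step_def Let_def)
  finally show ?case by (simp add: b_def)
qed

definition std_gaussian :: "'a::euclidean_space measure" where
  "std_gaussian = density lborel
     (\<lambda>x. ennreal ((2 * pi) powr (- real DIM('a) / 2) * exp (- (norm x)\<^sup>2 / 2)))"

definition uhmc_kernel :: "('a::euclidean_space \<Rightarrow> real) \<Rightarrow> real \<Rightarrow> real \<Rightarrow> 'a \<Rightarrow> 'a measure" where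
  "uhmc_kernel U T h x = distr std_gaussian borel (\<lambda>\<xi>. verlet_pos U h T x \<xi>)"

text \<open>
  The action \<open>\<nu>K\<close> of a kernel on a measure is the monadic bind \<open>\<nu> \<bind> K\<close>.
\<close>

fun kernel_power :: "('a::topological_space \<Rightarrow> 'a measure) \<Rightarrow> nat \<Rightarrow> 'a \<Rightarrow> 'a measure" where
  "kernel_power K 0 x = return borel x"
| "kernel_power K (Suc m) x = kernel_power K m x \<bind> K"

definition borel_prob :: "'a::topological_space measure \<Rightarrow> bool" where
  "borel_prob \<nu> \<longleftrightarrow> prob_space \<nu> \<and> sets \<nu> = sets borel"

definition target :: "('a::euclidean_space \<Rightarrow> real) \<Rightarrow> 'a measure" where
  "target U = density lborel (\<lambda>x. ennreal (exp (- U x) / (\<integral>y. exp (- U y) \<partial>lborel)))"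

definition TV :: "'a::topological_space measure \<Rightarrow> 'a measure \<Rightarrow> real" where
  "TV \<nu> \<eta> = (SUP A\<in>sets borel. \<bar>measure \<nu> A - measure \<eta> A\<bar>)"

definition couplings :: "'a::topological_space measure \<Rightarrow> 'a measure \<Rightarrow> ('a \<times> 'a) measure set" where
  "couplings \<nu> \<eta> = {\<gamma>. prob_space \<gamma> \<and> sets \<gamma> = sets (borel \<Otimes>\<^sub>M borel) \<and>
     distr \<gamma> borel fst = \<nu> \<and> distr \<gamma> borel snd = \<eta>}"

definition W1 :: "'a::euclidean_space measure \<Rightarrow> 'a measure \<Rightarrow> ennreal" where
  "W1 \<nu> \<eta> = (INF \<gamma>\<in>couplings \<nu> \<eta>. \<integral>\<^sup>+ z. ennreal (norm (fst z - snd z)) \<partial>\<gamma>)"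

end

theory Submission
  imports Defs
begin

text \<open>
  Invariance of \<open>\<mu>'\<close>, the contraction (A5) and a coupling reduce the claim to the one-step smoothing
  estimate \<open>TV (\<delta>\<^sub>x K) (\<delta>\<^sub>y K) \<le> C |x - y|\<close>. For fixed \<open>x\<close> the position \<open>F\<^sub>x v\<close> reached at time \<open>T\<close> is a
  small perturbation of \<open>T v\<close>, hence a diffeomorphism in the velocity \<open>v\<close>, and \<open>K x\<close> has an explicit
  density in terms of \<open>G\<^sub>x = F\<^sub>x\<^sup>-\<^sup>1\<close>. The Hellinger affinity of two such densities is bounded below by
  the change of variables \<open>m = (G\<^sub>x + G\<^sub>y) / 2\<close>: the midpoint cancels all first-order terms, so no
  integration by parts is needed, and what remains is quadratic in \<open>|G\<^sub>x - G\<^sub>y|\<close>, of order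
  \<open>|x - y| / T\<close>, and in the difference of the Jacobians, of relative order \<open>L\<^sub>H T\<^sup>2 |x - y|\<close> by a
  discrete Gronwall argument.
\<close>

section \<open>Determinants and near-scaling maps\<close>

text \<open>The affinity bound costs a square root: a deficit \<open>a\<close> of the affinity only
  yields the distance \<open>sqrt (2 * a)\<close>. A bound that is Lipschitz in |x - y| thus needs a
  deficit quadratic in |x - y|; a first-order deficit would leave a Hoelder bound of order 1/2. The
  midpoint removes the first-order part twice: through the parallelogram law in the Gaussian factor,
  and because det (I + B) det (I - B) depends only on B^2 in the Jacobian factor. This also fixes
  the role of the dimension: det (I - B^2) costs \<open>d * b^2\<close>, hence a single factor
  \<open>d\<close> under the root. The leading factor of the lower bound is the density of an image
  of the Gaussian under the inverse midpoint map, so its integral is exactly 1. The numerical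
  constants all come from \<open>L * T^2 <= 1/6\<close>: the forces have total weight T^2 / 2, so a
  force of size \<open>L * B\<close> moves the final position by at most \<open>B / 12\<close>, and
  12/11 = 1 / (1 - 1/12) is the Gronwall factor.\<close>

text \<open>Compare volumes: an expanding linear map is onto, so the image of the unit ball contains
  the ball of radius \<open>m\<close>. This replaces an argument with eigenvalues.\<close>

lemma det_ge_power_of_expansion:
  fixes f :: "real^'k::{finite,wellorder} \<Rightarrow> real^'k::_"
  assumes lin: "linear f" and m: "0 \<le> m" and exp: "\<And>v. m * norm v \<le> norm (f v)"
  shows "m ^ CARD('k) \<le> \<bar>det (matrix f)\<bar>"
proof (cases "m = 0")
  case False
  with m have m: "m > 0" by simp
  have "inj f"
  proof (subst linear_injective_0[OF lin], intro allI impI)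
    fix v assume "f v = 0"
    with exp[of v] m show "v = 0" by (simp add: mult_le_0_iff)
  qed
  then have surj: "surj f" using lin linear_injective_imp_surjective by blast
  have sub: "cball 0 m \<subseteq> f ` cball 0 1"
  proof
    fix y :: "real^'k::_" assume y: "y \<in> cball 0 m"
    obtain x where x: "y = f x" using surj by blast
    have "m * norm x \<le> m * 1" using exp[of x] x y by simp
    then have "norm x \<le> 1" using m by (metis mult_le_cancel_left_pos)
    then show "y \<in> f ` cball 0 1" using x by auto
  qed
  have "measure lebesgue (cball (0::real^'k::_) m) \<le> measure lebesgue (f ` cball 0 1)"
    by (rule measure_mono_fmeasurable[OF sub]) (auto intro: measurable_linear_image[OF lin])
  also have "\<dots> = \<bar>det (matrix f)\<bar> * measure lebesgue (cball (0::real^'k::_) 1)"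
    by (rule measure_linear_image[OF lin]) simp
  finally show ?thesis
    using m by (simp add: content_cball mult.commute)
qed (simp add: zero_power)

text \<open>
  With \<open>N = (P + Q) / 2\<close> and \<open>B = (P - Q) / 2 \<circ> N\<^sup>-\<^sup>1\<close> one has \<open>P = (I + B) N\<close>, \<open>Q = (I - B) N\<close>, so that
  the first-order terms cancel in \<open>det P * det Q = det (I - B\<^sup>2) * (det N)\<^sup>2\<close>.
\<close>

lemma det_mean_le:
  fixes P Q :: "real^'k::{finite,wellorder} \<Rightarrow> real^'k::_"
  assumes P: "linear P" and Q: "linear Q" and b: "0 \<le> b" "b \<le> 1"
    and PQ: "\<And>u. norm (P u - Q u) \<le> b * norm (P u + Q u)"
  shows "(1 - b\<^sup>2) ^ CARD('k) * (det (matrix (\<lambda>u. (1/2) *\<^sub>R (P u + Q u))))\<^sup>2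
    \<le> \<bar>det (matrix P)\<bar> * \<bar>det (matrix Q)\<bar>"
proof -
  define N where "N = (\<lambda>u. (1/2) *\<^sub>R (P u + Q u))"
  have N: "linear N"
    unfolding N_def using P Q by (intro linear_compose_scale_right linear_compose_add)
  show ?thesis
  proof (cases "det (matrix N) = 0")
    case False
    then have "inj N" by (simp add: det_nz_iff_inj N)
    then have surj: "surj N" and lin_inv: "linear (inv N)"
      using N linear_injective_imp_surjective inj_linear_imp_inv_linear by blast+
    have NN: "N (inv N w) = w" "inv N (N w) = w" for w
      using surj \<open>inj N\<close> by (auto simp: surj_f_inv_f)
    define B where "B = (\<lambda>w. (1/2) *\<^sub>R (P (inv N w) - Q (inv N w)))"
    have B: "linear B"
      unfolding B_def
      using linear_compose[OF lin_inv P] linear_compose[OF lin_inv Q]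
      by (intro linear_compose_scale_right linear_compose_sub) (simp_all add: o_def)
    have B_le: "norm (B w) \<le> b * norm w" for w
    proof -
      have "P (inv N w) + Q (inv N w) = 2 *\<^sub>R w"
        using arg_cong[OF NN(1)[of w], of "\<lambda>y. 2 *\<^sub>R y"] by (simp add: N_def)
      with PQ[of "inv N w"] show ?thesis by (simp add: B_def)
    qed
    have IB: "linear (\<lambda>w. w + B w)" "linear (\<lambda>w. w - B w)"
      using B by (auto intro: linear_compose_add linear_compose_sub linear_ident)
    have "(1/2) *\<^sub>R (x + y) + (1/2) *\<^sub>R (x - y) = x" "(1/2) *\<^sub>R (x + y) - (1/2) *\<^sub>R (x - y) = y" for x y :: "real^'k::_"
      by (simp_all add: vec_eq_iff field_simps)
    then have "P = (\<lambda>w. w + B w) \<circ> N" "Q = (\<lambda>w. w - B w) \<circ> N"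
      by (auto simp: fun_eq_iff B_def NN) (auto simp: N_def)
    then have "matrix P = matrix (\<lambda>w. w + B w) ** matrix N" "matrix Q = matrix (\<lambda>w. w - B w) ** matrix N"
      using matrix_compose[OF N] IB by metis+
    then have "\<bar>det (matrix P)\<bar> * \<bar>det (matrix Q)\<bar> =
        \<bar>det (matrix (\<lambda>w. w + B w) ** matrix (\<lambda>w. w - B w))\<bar> * (det (matrix N))\<^sup>2"
      by (simp add: det_mul abs_mult power2_eq_square)
    also have "matrix (\<lambda>w. w + B w) ** matrix (\<lambda>w. w - B w) = matrix ((\<lambda>w. w + B w) \<circ> (\<lambda>w. w - B w))"
      using matrix_compose IB by metis
    also have "(\<lambda>w. w + B w) \<circ> (\<lambda>w. w - B w) = (\<lambda>w. w - B (B w))"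
      by (simp add: fun_eq_iff linear_diff[OF B])
    finally have eq: "\<bar>det (matrix P)\<bar> * \<bar>det (matrix Q)\<bar> =
        \<bar>det (matrix (\<lambda>w. w - B (B w)))\<bar> * (det (matrix N))\<^sup>2" .
    \<comment> \<open>\<open>B\<close> has norm at most \<open>b\<close>, so I - B^2 shrinks no
      vector by more than the factor \<open>1 - b^2\<close>.\<close>
    have "(1 - b\<^sup>2) ^ CARD('k) \<le> \<bar>det (matrix (\<lambda>w. w - B (B w)))\<bar>"
    proof (rule det_ge_power_of_expansion)
      show "linear (\<lambda>w. w - B (B w))"
        using linear_compose[OF B B] by (intro linear_compose_sub linear_ident) (simp add: o_def)
      show "0 \<le> 1 - b\<^sup>2" using b by (simp add: power_le_one)
      fix w
      have "norm (B (B w)) \<le> b * (b * norm w)"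
        using B_le[of "B w"] B_le[of w] b(1) mult_left_mono order_trans by blast
      then show "(1 - b\<^sup>2) * norm w \<le> norm (w - B (B w))"
        using norm_triangle_ineq2[of w "B (B w)"] by (simp add: algebra_simps power2_eq_square)
    qed
    then show ?thesis
      unfolding eq N_def[symmetric] by (intro mult_right_mono) auto
  qed (simp add: N_def)
qed

text \<open>By the mean value theorem \<open>f\<close> minus the scaling by \<open>T\<close> has
  Lipschitz constant \<open>\<theta> * T\<close>. Hence \<open>f\<close> expands distances by at
  least \<open>(1 - \<theta>) * T\<close>, which gives injectivity and a Lipschitz inverse;
  surjectivity is a fixed point argument, and the inverse inherits differentiability because each
  \<open>f' v\<close> is invertible by the same expansion.\<close>

lemma near_scaling_inverse:
  fixes f :: "'a::euclidean_space \<Rightarrow> 'a"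
  assumes T: "T > 0" and \<theta>: "0 \<le> \<theta>" "\<theta> < 1"
    and f: "\<And>v. (f has_derivative f' v) (at v)"
    and f': "\<And>v u. norm (f' v u - T *\<^sub>R u) \<le> \<theta> * T * norm u"
  shows near_scaling_bij: "bij f"
    and near_scaling_inverse_derivative:
      "\<exists>g'. \<forall>z. (inv f has_derivative g' z) (at z) \<and> (\<forall>u. f' (inv f z) (g' z u) = u)"
proof -
  have lip: "norm ((f v - T *\<^sub>R v) - (f w - T *\<^sub>R w)) \<le> \<theta> * T * norm (v - w)" for v w
  proof (rule differentiable_bound[where S = UNIV and f = "\<lambda>v. f v - T *\<^sub>R v" and f' = "\<lambda>v u. f' v u - T *\<^sub>R u"])
    fix v
    show "((\<lambda>v. f v - T *\<^sub>R v) has_derivative (\<lambda>u. f' v u - T *\<^sub>R u)) (at v)"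
      by (intro derivative_intros f)
    show "onorm (\<lambda>u. f' v u - T *\<^sub>R u) \<le> \<theta> * T"
      by (rule onorm_le) (rule f')
  qed auto
  have exp: "(1 - \<theta>) * T * norm (v - w) \<le> norm (f v - f w)" for v w
  proof -
    have "norm (T *\<^sub>R (v - w)) - norm (f v - f w) \<le> norm (T *\<^sub>R (v - w) - (f v - f w))"
      by (rule norm_triangle_ineq2)
    also have "\<dots> = norm ((f v - T *\<^sub>R v) - (f w - T *\<^sub>R w))"
      by (simp add: norm_minus_commute algebra_simps)
    also have "\<dots> \<le> \<theta> * T * norm (v - w)" by (rule lip)
    finally show ?thesis using T by (simp add: left_diff_distrib)
  qed
  have pos: "(1 - \<theta>) * T > 0" using T \<theta> by simp
  have inj: "inj f"
  proof (rule injI)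
    fix v w assume "f v = f w"
    with exp[of v w] T \<theta> show "v = w" by (simp add: mult_le_0_iff)
  qed
  have "\<exists>v. f v = z" for z
  proof -
    \<comment> \<open>The fixed points of this map are the solutions of \<open>f v = z\<close>. Its
      increments are those of \<open>f\<close> minus the scaling, divided by \<open>-T\<close>, so
      it contracts by \<open>\<theta>\<close>.\<close>
    have "\<exists>!v. v + (1/T) *\<^sub>R (z - f v) = v"
    proof (rule banach_fix_type[OF \<theta>], intro allI)
      fix v w
      have "norm ((1/T) *\<^sub>R ((f v - T *\<^sub>R v) - (f w - T *\<^sub>R w))) \<le> (1/T) * (\<theta> * T * norm (v - w))"
        using lip[of v w] T by (simp add: pos_divide_le_eq mult_ac)
      moreover have "(1/T) *\<^sub>R ((f v - T *\<^sub>R v) - (f w - T *\<^sub>R w)) = - ((v + (1/T) *\<^sub>R (z - f v)) - (w + (1/T) *\<^sub>R (z - f w)))"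
        using T by (simp add: algebra_simps)
      ultimately show "dist (v + (1/T) *\<^sub>R (z - f v)) (w + (1/T) *\<^sub>R (z - f w)) \<le> \<theta> * dist v w"
        using T by (simp only: dist_norm norm_minus_cancel) simp
    qed
    then obtain v where "v + (1/T) *\<^sub>R (z - f v) = v" by blast
    then have "f v = z" using T by simp
    then show ?thesis ..
  qed
  with inj show bij: "bij f" by (metis bijI surj_def)
  then have finv: "f (inv f z) = z" for z by (simp add: bij_is_surj surj_f_inv_f)
  have "(1 - \<theta>) * T * dist (inv f z) (inv f y) \<le> dist z y" for z y
    using exp[of "inv f z" "inv f y"] finv by (simp add: dist_norm)
  then have "dist (inv f z) (inv f y) \<le> 1 / ((1 - \<theta>) * T) * dist z y" for z y
    using pos by (simp add: field_simps)
  then have "lipschitz_on (1 / ((1 - \<theta>) * T)) UNIV (inv f)"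
    using pos by (intro lipschitz_onI) auto
  then have cont: "continuous (at z) (inv f)" for z
    using lipschitz_on_continuous_on continuous_on_eq_continuous_at open_UNIV by blast
  have "(inv f has_derivative inv (f' (inv f z))) (at z) \<and> (\<forall>u. f' (inv f z) (inv (f' (inv f z)) u) = u)" for z
  proof -
    let ?X = "f' (inv f z)"
    have lin: "linear ?X" using f has_derivative_linear by blast
    have "inj ?X"
    proof (subst linear_injective_0[OF lin], intro allI impI)
      fix u assume "?X u = 0"
      with f'[of "inv f z" u] T have "(1 - \<theta>) * T * norm u \<le> 0" by (simp add: algebra_simps)
      with T \<theta> show "u = 0" by (simp add: mult_le_0_iff)
    qed
    then have surj: "surj ?X" and lin_inv: "linear (inv ?X)"
      using lin linear_injective_imp_surjective inj_linear_imp_inv_linear by blast+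
    have "(inv f has_derivative inv ?X) (at z)"
      by (rule has_derivative_inverse_basic[OF f _ _ cont open_UNIV])
         (use lin_inv \<open>inj ?X\<close> finv in \<open>auto simp: linear_conv_bounded_linear\<close>)
    then show ?thesis using surj by (simp add: surj_f_inv_f)
  qed
  then show "\<exists>g'. \<forall>z. (inv f has_derivative g' z) (at z) \<and> (\<forall>u. f' (inv f z) (g' z u) = u)"
    by (intro exI[of _ "\<lambda>z. inv (f' (inv f z))"]) blast
qed

section \<open>Change of variables, and total variation by affinity\<close>

text \<open>Scalar form of the formula, read off from the vector-valued one through the
  identification \<open>vec\<close> of \<open>real\<close> with \<open>real^1\<close>.\<close>

lemma change_of_variables_real_valued:
  fixes f :: "real^'k::{finite,wellorder} \<Rightarrow> real" and g :: "real^'k::_ \<Rightarrow> real^'k::_"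
  assumes S: "S \<in> sets lebesgue"
    and der: "\<And>x. x \<in> S \<Longrightarrow> (g has_derivative g' x) (at x)"
    and inj: "inj_on g S" and f: "f absolutely_integrable_on g ` S"
  shows "(\<lambda>x. \<bar>det (matrix (g' x))\<bar> * f (g x)) absolutely_integrable_on S"
    and "integral S (\<lambda>x. \<bar>det (matrix (g' x))\<bar> * f (g x)) = integral (g ` S) f"
proof -
  have "(\<lambda>x. \<bar>det (matrix (g' x))\<bar> *\<^sub>R vec (f (g x)) :: real^1) absolutely_integrable_on S \<and>
      integral S (\<lambda>x. \<bar>det (matrix (g' x))\<bar> *\<^sub>R vec (f (g x))) = (vec (integral (g ` S) f) :: real^1)
    \<longleftrightarrow> (\<lambda>x. vec (f x) :: real^1) absolutely_integrable_on (g ` S) \<and>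
      integral (g ` S) (\<lambda>x. vec (f x)) = (vec (integral (g ` S) f) :: real^1)"
    by (rule has_absolute_integral_change_of_variables[OF S _ inj])
       (use der has_derivative_at_withinI in blast)
  then show "(\<lambda>x. \<bar>det (matrix (g' x))\<bar> * f (g x)) absolutely_integrable_on S"
    and "integral S (\<lambda>x. \<bar>det (matrix (g' x))\<bar> * f (g x)) = integral (g ` S) f"
    using f by (simp_all add: absolutely_integrable_on_1_iff integral_on_1_eq)
qed

text \<open>
  The usual bound of the total variation distance by the Hellinger distance; the Cauchy-Schwarz
  inequality is replaced by its pointwise version with the optimal weight \<open>sqrt (2 / a)\<close>.
\<close>

lemma set_integral_diff_le_affinity:
  fixes p q r :: "'b \<Rightarrow> real"
  assumes p: "integrable M p" and q: "integrable M q" and r: "integrable M r"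
    and nn: "\<And>x. 0 \<le> p x" "\<And>x. 0 \<le> q x" and r_le: "\<And>x. r x \<le> sqrt (p x * q x)"
    and one: "integral\<^sup>L M p = 1" "integral\<^sup>L M q = 1"
    and a: "0 < a" "1 - a \<le> integral\<^sup>L M r" and A: "A \<in> sets M"
  shows "\<bar>(LINT x:A|M. p x) - (LINT x:A|M. q x)\<bar> \<le> sqrt (2 * a)"
proof -
  have D_int: "integrable M (\<lambda>x. \<bar>p x - q x\<bar>)" using p q by simp
  have sA: "set_integrable M A p" "set_integrable M A q"
    using integrable_mult_indicator[OF A p] integrable_mult_indicator[OF A q]
    by (simp_all add: set_integrable_def)
  \<comment> \<open>Since \<open>p\<close> and \<open>q\<close> have the same mass, twice the
    integral of p - q over \<open>A\<close> is the integral of p - q against the sign that is 1 on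
    \<open>A\<close> and -1 off \<open>A\<close>.\<close>
  have half: "2 * \<bar>(LINT x:A|M. p x) - (LINT x:A|M. q x)\<bar> \<le> (\<integral>x. \<bar>p x - q x\<bar> \<partial>M)"
  proof -
    have eq: "(LINT x:A|M. p x) - (LINT x:A|M. q x) = (\<integral>x. indicator A x * (p x - q x) \<partial>M)"
      using sA unfolding set_integrable_def set_lebesgue_integral_def
      by (subst Bochner_Integration.integral_diff[symmetric]) (auto simp: algebra_simps)
    have i1: "integrable M (\<lambda>x. indicator A x * (p x - q x))"
      using integrable_mult_indicator[OF A, of "\<lambda>x. p x - q x"] p q by simp
    have "(\<integral>x. p x - q x \<partial>M) = 0" using p q one by simp
    then have "2 * (\<integral>x. indicator A x * (p x - q x) \<partial>M) =
        (\<integral>x. 2 * (indicator A x * (p x - q x)) - (p x - q x) \<partial>M)"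
      using i1 p q by simp
    also have "\<bar>\<dots>\<bar> \<le> (\<integral>x. \<bar>2 * (indicator A x * (p x - q x)) - (p x - q x)\<bar> \<partial>M)"
      by (rule integral_abs_bound)
    also have "(\<lambda>x. \<bar>2 * (indicator A x * (p x - q x)) - (p x - q x)\<bar>) = (\<lambda>x. \<bar>p x - q x\<bar>)"
      by (auto simp: fun_eq_iff indicator_def)
    finally show ?thesis unfolding eq by simp
  qed
  \<comment> \<open>With weight \<open>l\<close> the inequality between arithmetic and geometric
    mean integrates to the bound \<open>l * a + 2 / l\<close>; this \<open>l\<close> minimises it
    and makes both terms equal to \<open>sqrt (2 * a)\<close>.\<close>
  define l where "l = sqrt (2 / a)"
  have l: "l > 0" "l\<^sup>2 = 2 / a" using a by (auto simp: l_def)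
  have pw: "\<bar>p x - q x\<bar> \<le> l / 2 * (p x + q x - 2 * r x) + 1 / l * (p x + q x)" for x
  proof -
    define s t where "s = sqrt (p x)" and "t = sqrt (q x)"
    have st: "0 \<le> s" "0 \<le> t" "p x = s\<^sup>2" "q x = t\<^sup>2" "r x \<le> s * t"
      using nn r_le[of x] by (auto simp: s_def t_def real_sqrt_mult)
    have "\<bar>p x - q x\<bar> = \<bar>s - t\<bar> * (s + t)"
      using st abs_mult[of "s - t" "s + t"] by (simp add: power2_eq_square square_diff_square_factored mult.commute)
    also have "\<dots> \<le> l / 2 * \<bar>s - t\<bar>\<^sup>2 + 1 / (2 * l) * (s + t)\<^sup>2"
    proof -
      have "0 \<le> (l * \<bar>s - t\<bar> - (s + t))\<^sup>2 / (2 * l)" using l by simp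
      also have "\<dots> = l / 2 * \<bar>s - t\<bar>\<^sup>2 + 1 / (2 * l) * (s + t)\<^sup>2 - \<bar>s - t\<bar> * (s + t)"
        using l(1) by (simp add: power2_eq_square field_simps)
      finally show ?thesis by simp
    qed
    also have "\<dots> \<le> l / 2 * (p x + q x - 2 * r x) + 1 / (2 * l) * (2 * (p x + q x))"
    proof (intro add_mono mult_left_mono)
      show "\<bar>s - t\<bar>\<^sup>2 \<le> p x + q x - 2 * r x" using st by (simp add: power2_diff)
      show "(s + t)\<^sup>2 \<le> 2 * (p x + q x)"
        using st zero_le_power2[of "s - t"] by (simp add: power2_eq_square algebra_simps)
    qed (use l in auto)
    also have "1 / (2 * l) * (2 * (p x + q x)) = 1 / l * (p x + q x)"
      using l(1) by (simp add: field_simps)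
    finally show ?thesis .
  qed
  have "(\<integral>x. \<bar>p x - q x\<bar> \<partial>M) \<le> (\<integral>x. l / 2 * (p x + q x - 2 * r x) + 1 / l * (p x + q x) \<partial>M)"
    by (intro integral_mono D_int pw) (use p q r in auto)
  also have "\<dots> = l / 2 * (2 - 2 * integral\<^sup>L M r) + 2 / l"
    using p q r one by simp
  also have "\<dots> \<le> l / 2 * (2 * a) + 2 / l"
    using a l by (intro add_mono mult_left_mono) auto
  also have "\<dots> = 2 * sqrt (2 * a)"
  proof -
    have "l * a = sqrt (2 * a)" 
      unfolding l_def using a by (simp add: real_sqrt_mult real_sqrt_divide field_simps)
    moreover have "2 / l = sqrt (2 * a)" 
      unfolding l_def using a by (simp add: real_sqrt_mult real_sqrt_divide field_simps)
    ultimately show ?thesis by simp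
  qed
  finally show ?thesis using half by simp
qed

section \<open>Images of the standard Gaussian measure\<close>

definition gaussian_density :: "'a::euclidean_space \<Rightarrow> real" where
  "gaussian_density x = (2 * pi) powr (- real DIM('a) / 2) * exp (- (norm x)\<^sup>2 / 2)"

lemma gaussian_density_pos: "0 < gaussian_density x"
  by (simp add: gaussian_density_def)

lemma gaussian_density_measurable [measurable]: "gaussian_density \<in> borel_measurable borel"
  unfolding gaussian_density_def by measurable

lemma std_gaussian_eq: "std_gaussian = density lborel (\<lambda>x. ennreal (gaussian_density x))"
  by (simp add: std_gaussian_def gaussian_density_def)

lemma gaussian_density_prod:
  "gaussian_density (x::'a::euclidean_space) = (\<Prod>b\<in>Basis. std_normal_density (x \<bullet> b))"
proof -
  have "(\<Prod>b\<in>(Basis::'a set). std_normal_density (x \<bullet> b)) =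
      (1 / sqrt (2 * pi)) ^ DIM('a) * exp (\<Sum>b\<in>Basis. - (x \<bullet> b)\<^sup>2 / 2)"
    by (simp only: std_normal_density_def prod.distrib prod_constant exp_sum[OF finite_Basis])
  also have "(\<Sum>b\<in>Basis. - (x \<bullet> b)\<^sup>2 / 2) = - (norm x)\<^sup>2 / 2"
    unfolding power2_norm_eq_inner euclidean_inner[of x x]
    by (simp add: power2_eq_square sum_negf flip: sum_divide_distrib)
  also have "(1 / sqrt (2 * pi)) ^ DIM('a) = (2 * pi) powr (- real DIM('a) / 2)"
  proof -
    have "1 / sqrt (2 * pi) = (2 * pi) powr (- 1 / 2)"
      by (simp add: powr_minus_divide powr_half_sqrt)
    then show ?thesis by (simp add: powr_powr flip: powr_realpow)
  qed
  finally show ?thesis by (simp add: gaussian_density_def)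
qed

lemma nn_integral_gaussian_density: "(\<integral>\<^sup>+x. ennreal (gaussian_density (x::'a::euclidean_space)) \<partial>lborel) = 1"
proof -
  have "(\<integral>\<^sup>+x. ennreal (gaussian_density (x::'a)) \<partial>lborel) =
      (\<integral>\<^sup>+x. (\<Prod>b\<in>Basis. ennreal (std_normal_density (x \<bullet> b))) \<partial>(lborel :: 'a measure))"
    by (simp add: gaussian_density_prod prod_ennreal normal_density_nonneg)
  also have "\<dots> = (\<Prod>b\<in>(Basis :: 'a set). \<integral>\<^sup>+x. ennreal (std_normal_density x) \<partial>lborel)"
    by (rule nn_integral_lborel_prod) auto
  also have "(\<integral>\<^sup>+x. ennreal (std_normal_density x) \<partial>lborel) = 1"
    by (subst nn_integral_eq_integral) (auto simp: normal_density_nonneg)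
  finally show ?thesis by simp
qed

lemma prob_space_std_gaussian: "prob_space std_gaussian"
  by (rule prob_spaceI) (simp add: std_gaussian_eq emeasure_density nn_integral_gaussian_density)

lemma integrable_gaussian_density: "integrable lborel gaussian_density"
  by (rule integrableI_nonneg)
     (auto simp: nn_integral_gaussian_density gaussian_density_pos less_imp_le)

lemma gaussian_density_absolutely_integrable:
  assumes "S \<in> sets lebesgue"
  shows "gaussian_density absolutely_integrable_on S"
proof -
  have "integrable lebesgue (gaussian_density :: 'a \<Rightarrow> real)"
    using integrable_gaussian_density by (simp add: integrable_completion)
  then show ?thesis
    unfolding set_integrable_def by (rule integrable_mult_indicator[OF assms])
qed

text \<open>Bridge to the gauge integral, in which the change of variables is expressed.\<close>

lemma measure_std_gaussian:
  fixes S :: "'a::euclidean_space set"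
  assumes S: "S \<in> sets borel"
  shows "measure std_gaussian S = integral S gaussian_density"
proof -
  have si: "set_integrable lborel S gaussian_density"
    unfolding set_integrable_def
    using integrable_mult_indicator[OF _ integrable_gaussian_density] S by simp
  have "measure std_gaussian S = enn2real (\<integral>\<^sup>+x. ennreal (gaussian_density x) * indicator S x \<partial>lborel)"
    using S by (simp add: measure_def std_gaussian_eq emeasure_density)
  also have "(\<integral>\<^sup>+x. ennreal (gaussian_density x) * indicator S x \<partial>lborel) =
      (\<integral>\<^sup>+x. ennreal (indicator S x *\<^sub>R gaussian_density x) \<partial>lborel)"
    by (intro nn_integral_cong) (auto simp: indicator_def)
  also have "enn2real \<dots> = (LINT x:S|lborel. gaussian_density x)"
    unfolding set_lebesgue_integral_def
    using S by (intro integral_eq_nn_integral[symmetric]) (auto simp: gaussian_density_pos less_imp_le)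
  also have "\<dots> = integral S gaussian_density"
    by (rule set_borel_integral_eq_integral(2)[OF si])
  finally show ?thesis .
qed

text \<open>The parallelogram law in the exponent: |x|^2 + |y|^2 is twice the squared norm of the
  midpoint plus half of |x - y|^2.\<close>

lemma gaussian_density_midpoint:
  "gaussian_density x * gaussian_density y =
    (gaussian_density ((1/2) *\<^sub>R (x + y)) * exp (- (norm (x - y))\<^sup>2 / 8))\<^sup>2"
proof -
  have "- (norm x)\<^sup>2 / 2 + - (norm y)\<^sup>2 / 2 =
      2 * (- (norm ((1/2) *\<^sub>R (x + y)))\<^sup>2 / 2 + - (norm (x - y))\<^sup>2 / 8)"
    by (simp add: power2_norm_eq_inner inner_simps inner_commute field_simps)
  then show ?thesis
    by (simp add: gaussian_density_def power2_eq_square mult_ac flip: exp_add)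
qed

text \<open>Change of variables along \<open>inv F\<close>, which maps \<open>A\<close> onto its
  preimage under \<open>F\<close>. It serves for the two position maps and, with the inverse of the
  midpoint map as \<open>F\<close>, to normalise the lower bound of the affinity.\<close>

lemma pushforward_density:
  fixes F :: "real^'k::{finite,wellorder} \<Rightarrow> real^'k::_"
  assumes bij: "bij F" and F: "F \<in> borel_measurable borel"
    and der: "\<And>z. (inv F has_derivative P z) (at z)"
  defines "p \<equiv> \<lambda>z. \<bar>det (matrix (P z))\<bar> * gaussian_density (inv F z)"
  shows "integrable lebesgue p" and "integral\<^sup>L lebesgue p = 1"
    and "A \<in> sets borel \<Longrightarrow> (LINT z:A|lebesgue. p z) = measure std_gaussian (F -` A)"
proof -
  have *: "set_integrable lebesgue A p \<and> (LINT z:A|lebesgue. p z) = measure std_gaussian (F -` A)"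
    if A: "A \<in> sets borel" for A
  proof -
    have img: "inv F ` A = F -` A"
      using bij by (simp add: bij_vimage_eq_inv_image)
    have FA: "F -` A \<in> sets borel" using measurable_sets[OF F A] by simp
    have inj: "inj_on (inv F) A" using bij by (metis bij_imp_bij_inv bij_is_inj inj_on_subset subset_UNIV)
    have ai: "gaussian_density absolutely_integrable_on inv F ` A"
      unfolding img using FA by (intro gaussian_density_absolutely_integrable) simp
    have A': "A \<in> sets lebesgue" using A by simp
    note cv = change_of_variables_real_valued[OF A' der inj ai]
    then show ?thesis
      unfolding p_def using FA
      by (simp add: measure_std_gaussian img set_lebesgue_integral_eq_integral(2))
  qed
  from *[of UNIV] show "integrable lebesgue p"
    by (simp add: set_integrable_def)
  have "measure std_gaussian (space (std_gaussian :: (real^'k::_) measure)) = 1"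
    by (rule prob_space.prob_space[OF prob_space_std_gaussian])
  with *[of UNIV] show "integral\<^sup>L lebesgue p = 1"
    by (simp add: set_lebesgue_integral_def std_gaussian_def)
  show "(LINT z:A|lebesgue. p z) = measure std_gaussian (F -` A)" if "A \<in> sets borel"
    using *[OF that] by blast
qed

text \<open>Inverting a scaling perturbed by 1/10 gives 10/9 = 1 / (1 - 1/10), and the relative
  error becomes 1/10 times 10/9, that is 1/9.\<close>

lemma inverse_near_scaling:
  fixes X P :: "'a::euclidean_space \<Rightarrow> 'a"
  assumes T: "T > 0" and X: "\<And>u. norm (X u - T *\<^sub>R u) \<le> 1 / 10 * T * norm u" and XP: "\<And>u. X (P u) = u"
  shows "T * norm (P u) \<le> 10 / 9 * norm u" and "norm (P u - (1/T) *\<^sub>R u) \<le> 1 / 9 * (1 / T) * norm u"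
proof -
  have 1: "norm (u - T *\<^sub>R P u) \<le> 1 / 10 * T * norm (P u)" using X[of "P u"] XP by simp
  have "norm (T *\<^sub>R P u) \<le> norm u + norm (u - T *\<^sub>R P u)"
    by (metis norm_triangle_sub norm_minus_commute)
  with 1 T show 2: "T * norm (P u) \<le> 10 / 9 * norm u" by simp
  have "P u - (1/T) *\<^sub>R u = - ((1/T) *\<^sub>R (u - T *\<^sub>R P u))" using T by (simp add: algebra_simps)
  then have "norm (P u - (1/T) *\<^sub>R u) = (1/T) * norm (u - T *\<^sub>R P u)" using T by simp
  also have "\<dots> \<le> (1/T) * (1 / 9 * norm u)" using 1 2 T by (intro mult_left_mono) auto
  finally show "norm (P u - (1/T) *\<^sub>R u) \<le> 1 / 9 * (1 / T) * norm u" by simp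
qed

text \<open>
  The Hellinger affinity of the two laws is estimated by the change of variables
  \<open>m = (F\<^sub>1\<^sup>-\<^sup>1 + F\<^sub>2\<^sup>-\<^sup>1) / 2\<close>: the Gaussian densities at \<open>F\<^sub>1\<^sup>-\<^sup>1 z\<close> and \<open>F\<^sub>2\<^sup>-\<^sup>1 z\<close> have geometric mean at least
  \<open>exp (- \<rho>\<^sup>2 / 8)\<close> times the density at \<open>m z\<close>, and the Jacobians compare with that of \<open>m\<close> by \<open>det_mean_le\<close>.
\<close>

lemma pushforward_gaussian_dist_wellorder:
  fixes F\<^sub>1 F\<^sub>2 :: "real^'k::{finite,wellorder} \<Rightarrow> real^'k::_"
  assumes T: "T > 0"
    and d1: "\<And>v. (F\<^sub>1 has_derivative X\<^sub>1 v) (at v)" and d2: "\<And>v. (F\<^sub>2 has_derivative X\<^sub>2 v) (at v)"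
    and n1: "\<And>v u. norm (X\<^sub>1 v u - T *\<^sub>R u) \<le> 1 / 10 * T * norm u"
    and n2: "\<And>v u. norm (X\<^sub>2 v u - T *\<^sub>R u) \<le> 1 / 10 * T * norm u"
    and \<rho>: "\<rho> > 0" "\<And>v w. F\<^sub>1 v = F\<^sub>2 w \<Longrightarrow> norm (v - w) \<le> \<rho>"
    and \<delta>: "\<delta> \<ge> 0" "\<And>v w u. F\<^sub>1 v = F\<^sub>2 w \<Longrightarrow> norm (X\<^sub>1 v u - X\<^sub>2 w u) \<le> \<delta> * norm u"
    and A: "A \<in> sets borel"
  shows "\<bar>measure std_gaussian (F\<^sub>1 -` A) - measure std_gaussian (F\<^sub>2 -` A)\<bar>
    \<le> sqrt (\<rho>\<^sup>2 / 4 + 2 * real CARD('k) * (\<delta> / T)\<^sup>2)"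
\<comment> \<open>For \<delta> > T the right-hand side exceeds 1 and the bound is trivial. Otherwise
  b = \<delta> / T lies in [0, 1], as \<open>det_mean_le\<close> demands.\<close>
proof (cases "\<delta> / T \<le> 1")
  case False
  then have "1 \<le> real CARD('k) * (\<delta> / T)\<^sup>2"
    using mult_mono[of 1 "real CARD('k)" 1 "(\<delta> / T)\<^sup>2"] by (simp add: one_le_power Suc_leI)
  then have "1 \<le> sqrt (\<rho>\<^sup>2 / 4 + 2 * real CARD('k) * (\<delta> / T)\<^sup>2)"
    by (intro real_le_rsqrt) (simp add: add_increasing)
  moreover have "\<bar>measure std_gaussian B - measure std_gaussian C\<bar> \<le> 1" for B C :: "(real^'k::_) set"
    using prob_space.prob_le_1[OF prob_space_std_gaussian] measure_nonneg by (smt (verit))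
  ultimately show ?thesis using order_trans by blast
next
  case b1: True
  define b where "b = \<delta> / T"
  have b: "0 \<le> b" "b \<le> 1" using b1 T \<delta>(1) by (auto simp: b_def)
  let ?d = "CARD('k)"
  have th: "(0::real) \<le> 1/10" "(1/10::real) < 1" by auto
  obtain P\<^sub>1 where P1: "\<And>z. (inv F\<^sub>1 has_derivative P\<^sub>1 z) (at z)" "\<And>z u. X\<^sub>1 (inv F\<^sub>1 z) (P\<^sub>1 z u) = u"
    using near_scaling_inverse_derivative[OF T th d1 n1] by blast
  obtain P\<^sub>2 where P2: "\<And>z. (inv F\<^sub>2 has_derivative P\<^sub>2 z) (at z)" "\<And>z u. X\<^sub>2 (inv F\<^sub>2 z) (P\<^sub>2 z u) = u"
    using near_scaling_inverse_derivative[OF T th d2 n2] by blast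
  have bij: "bij F\<^sub>1" "bij F\<^sub>2"
    using near_scaling_bij[OF T th d1 n1] near_scaling_bij[OF T th d2 n2] .
  have meas: "F\<^sub>1 \<in> borel_measurable borel" "F\<^sub>2 \<in> borel_measurable borel"
    using d1 d2 by (auto intro!: borel_measurable_continuous_onI has_derivative_continuous_on
        intro: has_derivative_at_withinI)
  have F_inv: "F\<^sub>1 (inv F\<^sub>1 z) = F\<^sub>2 (inv F\<^sub>2 z)" for z
    using bij by (simp add: bij_is_surj surj_f_inv_f)
  define m where "m z = (1/2) *\<^sub>R (inv F\<^sub>1 z + inv F\<^sub>2 z)" for z
  define N where "N z u = (1/2) *\<^sub>R (P\<^sub>1 z u + P\<^sub>2 z u)" for z u
  have m: "(m has_derivative N z) (at z)" for z
    unfolding m_def[abs_def] N_def[abs_def] by (intro derivative_intros P1 P2)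
  have near1: "T * norm (P\<^sub>1 z u) \<le> 10 / 9 * norm u" "norm (P\<^sub>1 z u - (1/T) *\<^sub>R u) \<le> 1 / 9 * (1 / T) * norm u"
    and near2: "T * norm (P\<^sub>2 z u) \<le> 10 / 9 * norm u" "norm (P\<^sub>2 z u - (1/T) *\<^sub>R u) \<le> 1 / 9 * (1 / T) * norm u" for z u
    using inverse_near_scaling[OF T n1[of "inv F\<^sub>1 z"] P1(2)[of z], of u]
      inverse_near_scaling[OF T n2[of "inv F\<^sub>2 z"] P2(2)[of z], of u] by auto
  have nearN: "norm (N z u - (1/T) *\<^sub>R u) \<le> 1 / 9 * (1 / T) * norm u" for z u
  proof -
    have "N z u - (1/T) *\<^sub>R u = (1/2) *\<^sub>R ((P\<^sub>1 z u - (1/T) *\<^sub>R u) + (P\<^sub>2 z u - (1/T) *\<^sub>R u))"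
      by (simp add: N_def vec_eq_iff field_simps)
    also have "norm \<dots> \<le> 1/2 * (1 / 9 * (1 / T) * norm u + 1 / 9 * (1 / T) * norm u)"
      using norm_triangle_mono[OF near1(2)[of z u] near2(2)[of z u]] by simp
    finally show ?thesis by simp
  qed
  have bij_m: "bij m"
    by (rule near_scaling_bij[OF _ _ _ m nearN]) (use T in auto)
  define p where "p z = \<bar>det (matrix (P\<^sub>1 z))\<bar> * gaussian_density (inv F\<^sub>1 z)" for z
  define q where "q z = \<bar>det (matrix (P\<^sub>2 z))\<bar> * gaussian_density (inv F\<^sub>2 z)" for z
  define c where "c = exp (- \<rho>\<^sup>2 / 8) * (1 - b\<^sup>2) ^ ?d"
  define r where "r z = c * (\<bar>det (matrix (N z))\<bar> * gaussian_density (m z))" for z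
  have b2: "0 \<le> 1 - b\<^sup>2" "1 - b\<^sup>2 \<le> 1" using b by (auto simp: power_le_one)
  \<comment> \<open>The inverse derivatives satisfy X1 s = u = X2 t, so X1 (s - t) = (X2 - X1) t is
    controlled by \<delta>. It remains to bound t by s + t, which holds because both vectors are
    close to u / T.\<close>
  have PP: "norm (P\<^sub>1 z u - P\<^sub>2 z u) \<le> b * norm (P\<^sub>1 z u + P\<^sub>2 z u)" for z u
  proof -
    define s t where "s = P\<^sub>1 z u" and "t = P\<^sub>2 z u"
    let ?X = "X\<^sub>1 (inv F\<^sub>1 z)"
    have "?X (s - t) = X\<^sub>2 (inv F\<^sub>2 z) t - ?X t"
      using P1(2) P2(2) linear_diff[OF has_derivative_linear[OF d1]] by (simp add: s_def t_def)
    then have "norm (?X (s - t)) \<le> \<delta> * norm t"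
      using \<delta>(2)[OF F_inv, of z t] by (simp add: norm_minus_commute)
    moreover have "T * norm (s - t) - norm (?X (s - t)) \<le> 1 / 10 * T * norm (s - t)"
      using n1[of "inv F\<^sub>1 z" "s - t"] norm_triangle_ineq2[of "T *\<^sub>R (s - t)" "?X (s - t)"] T
      by (simp add: norm_minus_commute)
    ultimately have 1: "9 / 10 * T * norm (s - t) \<le> \<delta> * norm t" by simp
    have 2: "T * norm t \<le> 10 / 9 * norm u" using near2(1) by (simp add: t_def)
    have "norm ((2/T) *\<^sub>R u) - norm (s + t) \<le> norm ((2/T) *\<^sub>R u - (s + t))"
      by (rule norm_triangle_ineq2)
    also have "(2/T) *\<^sub>R u - (s + t) = - ((s - (1/T) *\<^sub>R u) + (t - (1/T) *\<^sub>R u))"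
      by (simp add: vec_eq_iff field_simps)
    also have "norm \<dots> \<le> 1 / 9 * (1 / T) * norm u + 1 / 9 * (1 / T) * norm u"
      unfolding norm_minus_cancel s_def t_def by (rule norm_triangle_mono[OF near1(2) near2(2)])
    finally have "16 / 9 * norm u \<le> T * norm (s + t)" using T by (simp add: field_simps)
    with 2 have "T * (9 / 10 * norm t) \<le> T * (9 / 16 * norm (s + t))" by simp
    then have 3: "9 / 10 * norm t \<le> 9 / 16 * norm (s + t)" using T by (metis mult_le_cancel_left_pos)
    \<comment> \<open>The available factor 5/8 is relaxed to 9/10 so that it cancels the 9/10 on the
      left of inequality \<open>1\<close>.\<close>
    have "norm t \<le> 9 / 10 * norm (s + t)" using 3 norm_ge_zero[of "s + t"] by linarith
    then have "\<delta> * norm t \<le> \<delta> * (9 / 10 * norm (s + t))" using \<delta>(1) by (rule mult_left_mono)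
    with 1 have "T * norm (s - t) \<le> \<delta> * norm (s + t)" by simp
    then show ?thesis using T by (simp add: b_def s_def t_def field_simps)
  qed
  have r_le: "r z \<le> sqrt (p z * q z)" for z
  proof (rule real_le_rsqrt)
    define D where "D = \<bar>det (matrix (N z))\<bar>"
    have D: "(1 - b\<^sup>2) ^ ?d * D\<^sup>2 \<le> \<bar>det (matrix (P\<^sub>1 z))\<bar> * \<bar>det (matrix (P\<^sub>2 z))\<bar>"
      unfolding D_def N_def[abs_def] power2_abs
      by (rule det_mean_le[OF _ _ b PP]) (use P1(1) P2(1) has_derivative_linear in blast)+
    have "exp (- \<rho>\<^sup>2 / 8) \<le> exp (- (norm (inv F\<^sub>1 z - inv F\<^sub>2 z))\<^sup>2 / 8)"
      using \<rho>(2)[OF F_inv, of z] by (simp add: power_mono)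
    then have E: "(gaussian_density (m z) * exp (- \<rho>\<^sup>2 / 8))\<^sup>2 \<le> gaussian_density (inv F\<^sub>1 z) * gaussian_density (inv F\<^sub>2 z)"
      unfolding gaussian_density_midpoint m_def
      by (intro power_mono mult_left_mono) (auto simp: gaussian_density_pos less_imp_le)
    \<comment> \<open>\<open>det_mean_le\<close> would allow the square root of
      \<open>(1 - b^2) ^ d\<close> in \<open>c\<close>. Keeping the full power avoids half-integer
      exponents, at the price of a factor 2 in the loss \<open>d * b^2\<close>.\<close>
    have "((1 - b\<^sup>2) ^ ?d)\<^sup>2 \<le> (1 - b\<^sup>2) ^ ?d"
      using b2 by (simp add: power2_eq_square mult_left_le_one_le power_le_one)
    then have "((1 - b\<^sup>2) ^ ?d)\<^sup>2 * D\<^sup>2 \<le> \<bar>det (matrix (P\<^sub>1 z))\<bar> * \<bar>det (matrix (P\<^sub>2 z))\<bar>"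
      using D by (meson mult_right_mono order_trans zero_le_power2)
    from mult_mono[OF this E] show "(r z)\<^sup>2 \<le> p z * q z"
      by (simp add: r_def c_def p_def q_def D_def power_mult_distrib mult_ac)
  qed
  have bij': "bij (inv m)" using bij_m by (rule bij_imp_bij_inv)
  have inv_inv: "inv (inv m) = m" using bij_m by (rule inv_inv_eq)
  have m_meas: "inv m \<in> borel_measurable borel"
  proof -
    have T': "1 / T > 0" "(0::real) \<le> 1 / 9" "(1 / 9 :: real) < 1" using T by auto
    obtain m' where "\<And>z. (inv m has_derivative m' z) (at z)"
      using near_scaling_inverse_derivative[OF T' m nearN] by blast
    then show ?thesis
      by (auto intro!: borel_measurable_continuous_onI has_derivative_continuous_on intro: has_derivative_at_withinI)
  qed
  have m': "(inv (inv m) has_derivative N z) (at z)" for z unfolding inv_inv by (rule m)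
  \<comment> \<open>The midpoint map is a bijection, so |det N| times the Gaussian density at
    \<open>m z\<close> is itself a probability density; hence \<open>r\<close> integrates to
    \<open>c\<close>.\<close>
  note pd_m = pushforward_density(1,2)[OF bij' m_meas m', unfolded inv_inv]
  note pd1 = pushforward_density[OF bij(1) meas(1) P1(1), folded p_def]
  note pd2 = pushforward_density[OF bij(2) meas(2) P2(1), folded q_def]
  \<comment> \<open>The losses of the two factors of \<open>c\<close> simply add up, because e g >=
    e + g - 1 for e, g <= 1; the second loss is Bernoulli's inequality.\<close>
  define a where "a = \<rho>\<^sup>2 / 8 + real ?d * b\<^sup>2"
  have r: "integrable lebesgue r" "integral\<^sup>L lebesgue r = c"
    unfolding r_def[abs_def] using pd_m by simp_all
  have "1 - a \<le> c"
  proof -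
    define e g where "e = exp (- \<rho>\<^sup>2 / 8)" and "g = (1 - b\<^sup>2) ^ ?d"
    have "1 - \<rho>\<^sup>2 / 8 \<le> e" using exp_ge_add_one_self[of "- \<rho>\<^sup>2 / 8"] by (simp add: e_def)
    moreover have "1 - real ?d * b\<^sup>2 \<le> g"
      using Bernoulli_inequality[of "- b\<^sup>2" ?d] b by (simp add: g_def power_le_one)
    moreover have "e \<le> 1" "g \<le> 1" using b2 by (auto simp: e_def g_def power_le_one)
    then have "0 \<le> (1 - e) * (1 - g)" by simp
    moreover have "c = e * g" by (simp add: c_def e_def g_def)
    ultimately show ?thesis by (simp add: a_def algebra_simps)
  qed
  moreover have "a > 0" using \<rho>(1) by (simp add: a_def add_pos_nonneg)
  ultimately have "\<bar>(LINT z:A|lebesgue. p z) - (LINT z:A|lebesgue. q z)\<bar> \<le> sqrt (2 * a)"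
    using pd1(1,2) pd2(1,2) r r_le A
    by (intro set_integral_diff_le_affinity[where r = r])
       (auto simp: p_def q_def gaussian_density_pos less_imp_le)
  then show ?thesis using pd1(3)[OF A] pd2(3)[OF A] by (simp add: a_def b_def algebra_simps)
qed

section \<open>Relabelling of coordinates\<close>

definition reindex :: "('b::finite \<Rightarrow> 'a::finite) \<Rightarrow> real^'a \<Rightarrow> real^'b" where
  "reindex \<beta> x = (\<chi> j. x $ \<beta> j)"

lemma linear_reindex: "linear (reindex \<beta>)"
  by (rule linearI) (simp_all add: reindex_def vec_eq_iff)

lemma reindex_measurable [measurable]: "reindex \<beta> \<in> borel_measurable borel"
  using linear_continuous_on[OF linear_reindex[of \<beta>, unfolded linear_conv_bounded_linear]]
  by (rule borel_measurable_continuous_onI)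

lemma norm_reindex: "bij \<beta> \<Longrightarrow> norm (reindex \<beta> x) = norm x"
  unfolding norm_vec_def L2_set_def reindex_def
  using sum.reindex_bij_betw[of \<beta> UNIV UNIV "\<lambda>i. (norm (x $ i))\<^sup>2"] by simp

lemma reindex_inv: "bij \<beta> \<Longrightarrow> reindex \<beta> (reindex (inv \<beta>) y) = y" "bij \<beta> \<Longrightarrow> reindex (inv \<beta>) (reindex \<beta> x) = x"
  by (simp_all add: reindex_def vec_eq_iff bij_is_inj bij_is_surj surj_f_inv_f)

lemma prod_Basis_cart: "(\<Prod>b\<in>Basis. x \<bullet> b) = (\<Prod>i\<in>UNIV. x $ i)" for x :: "real^'n"
proof -
  have eq: "(Basis :: (real^'n) set) = range (\<lambda>i. axis i 1)"
    by (auto simp: Basis_vec_def)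
  have "inj (\<lambda>i::'n. axis i (1::real))"
    by (rule injI) (simp add: axis_eq_axis)
  then show ?thesis
    unfolding eq by (subst prod.reindex) (auto simp: inner_axis)
qed

text \<open>Relabelling permutes the sides of a box, and Lebesgue measure is determined by the
  volumes of boxes.\<close>

lemma distr_lborel_reindex:
  fixes \<beta> :: "'b::finite \<Rightarrow> 'a::finite"
  assumes \<beta>: "bij \<beta>"
  shows "distr lborel borel (reindex \<beta>) = lborel"
proof (rule lborel_eqI[symmetric])
  fix l u :: "real^'b" assume le: "\<And>b. b \<in> Basis \<Longrightarrow> l \<bullet> b \<le> u \<bullet> b"
  have le': "l $ j \<le> u $ j" for j using le[of "axis j 1"] by (simp add: inner_axis axis_in_Basis_iff)
  let ?l = "reindex (inv \<beta>) l" and ?u = "reindex (inv \<beta>) u"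
  have "(\<forall>j. Q j (\<beta> j)) \<longleftrightarrow> (\<forall>i. Q (inv \<beta> i) i)" for Q
    using \<beta> by (metis bij_inv_eq_iff)
  from this[of "\<lambda>j i. l $ j < x $ i \<and> x $ i < u $ j" for x]
  have "reindex \<beta> -` box l u = box ?l ?u"
    by (simp add: set_eq_iff mem_box_cart reindex_def)
  then have "emeasure (distr lborel borel (reindex \<beta>)) (box l u) = emeasure lborel (box ?l ?u)"
    by (simp add: emeasure_distr)
  also have "\<dots> = (\<Prod>b\<in>Basis. (?u - ?l) \<bullet> b)"
  proof -
    have "?l \<bullet> b \<le> ?u \<bullet> b" if "b \<in> Basis" for b
      using that le' by (auto simp: Basis_vec_def inner_axis reindex_def)
    then show ?thesis by (rule emeasure_lborel_box)
  qed
  also have "\<dots> = (\<Prod>b\<in>Basis. (u - l) \<bullet> b)"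
    unfolding prod_Basis_cart
    using prod.reindex_bij_betw[OF bij_imp_bij_inv[OF \<beta>], of "\<lambda>i. (u - l) $ i"] by (simp add: reindex_def)
  finally show "emeasure (distr lborel borel (reindex \<beta>)) (box l u) = (\<Prod>b\<in>Basis. (u - l) \<bullet> b)" .
qed simp

lemma distr_std_gaussian_reindex:
  fixes \<beta> :: "'b::finite \<Rightarrow> 'a::finite"
  assumes \<beta>: "bij \<beta>"
  shows "distr std_gaussian borel (reindex \<beta>) = std_gaussian"
proof -
  have "CARD('b) = CARD('a)" using \<beta> by (rule bij_betw_same_card)
  then have "gaussian_density (reindex \<beta> x) = gaussian_density x" for x :: "real^'a"
    by (simp add: gaussian_density_def norm_reindex[OF \<beta>])
  then have "distr std_gaussian borel (reindex \<beta>) =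
      distr (density lborel (\<lambda>x. ennreal (gaussian_density (reindex \<beta> x)))) borel (reindex \<beta>)"
    by (simp add: std_gaussian_eq)
  also have "\<dots> = density (distr lborel borel (reindex \<beta>)) (\<lambda>x. ennreal (gaussian_density x))"
    by (subst density_distr) auto
  finally show ?thesis by (simp add: distr_lborel_reindex[OF \<beta>] std_gaussian_eq)
qed

text \<open>
  The change of variables formula of the library is available only for well-ordered index types;
  this copy of the index type supplies the order.
\<close>

typedef 'n ordered_index = "{..<CARD('n::finite)}"
  by (rule exI[of _ 0]) simp

lemma bij_betw_Rep_ordered_index:
  "bij_betw Rep_ordered_index (UNIV :: 'n::finite ordered_index set) {..<CARD('n)}"
  by (rule bij_betwI[of _ _ _ Abs_ordered_index])
     (use Rep_ordered_index in \<open>auto simp: Rep_ordered_index_inverse Abs_ordered_index_inverse\<close>)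

instance ordered_index :: (finite) finite
  by standard (use bij_betw_Rep_ordered_index bij_betw_finite in blast)

instantiation ordered_index :: (finite) wellorder
begin

definition less_eq_ordered_index :: "'a ordered_index \<Rightarrow> 'a ordered_index \<Rightarrow> bool" where
  "less_eq_ordered_index i j \<longleftrightarrow> Rep_ordered_index i \<le> Rep_ordered_index j"

definition less_ordered_index :: "'a ordered_index \<Rightarrow> 'a ordered_index \<Rightarrow> bool" where
  "less_ordered_index i j \<longleftrightarrow> Rep_ordered_index i < Rep_ordered_index j"

instance
proof
  fix P :: "'a ordered_index \<Rightarrow> bool" and i
  assume step: "\<And>i. (\<And>j. j < i \<Longrightarrow> P j) \<Longrightarrow> P i"
  show "P i"
    by (induction i rule: measure_induct_rule[of Rep_ordered_index])
       (use step in \<open>auto simp: less_ordered_index_def\<close>)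
qed (auto simp: less_eq_ordered_index_def less_ordered_index_def Rep_ordered_index_inject)

end

text \<open>The hypotheses and the Gaussian measure are invariant under conjugation with a
  relabelling isometry, so the estimate carries over from ordered index types to arbitrary finite
  ones.\<close>

lemma pushforward_gaussian_dist:
  fixes F\<^sub>1 F\<^sub>2 :: "real^'n \<Rightarrow> real^'n"
  assumes T: "T > 0"
    and d1: "\<And>v. (F\<^sub>1 has_derivative X\<^sub>1 v) (at v)" and d2: "\<And>v. (F\<^sub>2 has_derivative X\<^sub>2 v) (at v)"
    and n1: "\<And>v u. norm (X\<^sub>1 v u - T *\<^sub>R u) \<le> 1 / 10 * T * norm u"
    and n2: "\<And>v u. norm (X\<^sub>2 v u - T *\<^sub>R u) \<le> 1 / 10 * T * norm u"
    and \<rho>: "\<rho> > 0" "\<And>v w. F\<^sub>1 v = F\<^sub>2 w \<Longrightarrow> norm (v - w) \<le> \<rho>"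
    and \<delta>: "\<delta> \<ge> 0" "\<And>v w u. F\<^sub>1 v = F\<^sub>2 w \<Longrightarrow> norm (X\<^sub>1 v u - X\<^sub>2 w u) \<le> \<delta> * norm u"
    and A: "A \<in> sets borel"
  shows "\<bar>measure std_gaussian (F\<^sub>1 -` A) - measure std_gaussian (F\<^sub>2 -` A)\<bar>
    \<le> sqrt (\<rho>\<^sup>2 / 4 + 2 * real CARD('n) * (\<delta> / T)\<^sup>2)"
proof -
  have card: "CARD('n ordered_index) = CARD('n)"
    using bij_betw_same_card[OF bij_betw_Rep_ordered_index[where 'n = 'n]] by simp
  obtain \<beta> :: "'n \<Rightarrow> 'n ordered_index" where \<beta>: "bij \<beta>"
    using finite_same_card_bij[OF finite finite, of UNIV UNIV] card by metis
  define \<kappa> \<iota> where "\<kappa> = reindex \<beta>" and "\<iota> = reindex (inv \<beta>)"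
  note \<beta>' = bij_imp_bij_inv[OF \<beta>]
  have lin: "linear \<kappa>" "linear \<iota>" by (simp_all add: \<kappa>_def \<iota>_def linear_reindex)
  have norm: "norm (\<kappa> y) = norm y" "norm (\<iota> x) = norm x" for x y
    by (simp_all add: \<kappa>_def \<iota>_def norm_reindex \<beta> \<beta>')
  have inv: "\<kappa> (\<iota> x) = x" "\<iota> (\<kappa> y) = y" for x y
    by (simp_all add: \<kappa>_def \<iota>_def reindex_inv \<beta>)
  have der: "((\<lambda>y. \<iota> (F (\<kappa> y))) has_derivative (\<lambda>u. \<iota> (X (\<kappa> v) (\<kappa> u)))) (at v)"
    if "\<And>v. (F has_derivative X v) (at v)" for F X v
  proof -
    have "(\<kappa> has_derivative \<kappa>) (at v)" "\<And>v. (\<iota> has_derivative \<iota>) (at v)"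
      using lin by (auto simp: linear_conv_bounded_linear intro: bounded_linear_imp_has_derivative)
    from has_derivative_compose[OF has_derivative_compose[OF this(1) that] this(2)] show ?thesis .
  qed
  have near: "norm (\<iota> (X (\<kappa> v) (\<kappa> u)) - T *\<^sub>R u) \<le> 1 / 10 * T * norm u"
    if "\<And>v u. norm (X v u - T *\<^sub>R u) \<le> 1 / 10 * T * norm u" for X v u
    using that[of "\<kappa> v" "\<kappa> u"] norm(2)[of "X (\<kappa> v) (\<kappa> u) - T *\<^sub>R \<kappa> u"] norm(1)[of u]
    by (simp add: linear_diff[OF lin(2)] linear_scale[OF lin(2)] inv)
  have F_eq: "F\<^sub>1 (\<kappa> v) = F\<^sub>2 (\<kappa> w)" if "\<iota> (F\<^sub>1 (\<kappa> v)) = \<iota> (F\<^sub>2 (\<kappa> w))" for v w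
    using that inv(1) by metis
  have A': "\<kappa> -` A \<in> sets borel"
    using measurable_sets[OF reindex_measurable A] by (simp add: \<kappa>_def)
  have "\<bar>measure std_gaussian ((\<lambda>y. \<iota> (F\<^sub>1 (\<kappa> y))) -` (\<kappa> -` A)) - measure std_gaussian ((\<lambda>y. \<iota> (F\<^sub>2 (\<kappa> y))) -` (\<kappa> -` A))\<bar>
      \<le> sqrt (\<rho>\<^sup>2 / 4 + 2 * real CARD('n ordered_index) * (\<delta> / T)\<^sup>2)"
  proof (rule pushforward_gaussian_dist_wellorder[OF T der[OF d1] der[OF d2] near[of X\<^sub>1, OF n1] near[of X\<^sub>2, OF n2] \<rho>(1) _ \<delta>(1) _ A'])
    fix v w u assume "\<iota> (F\<^sub>1 (\<kappa> v)) = \<iota> (F\<^sub>2 (\<kappa> w))"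
    note eq = F_eq[OF this]
    show "norm (v - w) \<le> \<rho>"
      using \<rho>(2)[OF eq] norm(1)[of "v - w"] by (simp add: linear_diff[OF lin(1)])
    show "norm (\<iota> (X\<^sub>1 (\<kappa> v) (\<kappa> u)) - \<iota> (X\<^sub>2 (\<kappa> w) (\<kappa> u))) \<le> \<delta> * norm u"
      using \<delta>(2)[OF eq, of "\<kappa> u"] norm(2)[of "X\<^sub>1 (\<kappa> v) (\<kappa> u) - X\<^sub>2 (\<kappa> w) (\<kappa> u)"] norm(1)[of u]
      by (simp add: linear_diff[OF lin(2)])
  qed
  moreover have "measure std_gaussian ((\<lambda>y. \<iota> (F (\<kappa> y))) -` (\<kappa> -` A)) = measure std_gaussian (F -` A)"
    if d: "\<And>v. (F has_derivative X v) (at v)" for F X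
  proof -
    have "F \<in> borel_measurable borel"
      using d by (auto intro!: borel_measurable_continuous_onI has_derivative_continuous_on
          intro: has_derivative_at_withinI)
    then have FA: "F -` A \<in> sets borel" using measurable_sets[of F borel borel A] A by simp
    have "(\<lambda>y. \<iota> (F (\<kappa> y))) -` (\<kappa> -` A) = \<kappa> -` (F -` A) \<inter> space std_gaussian"
      by (auto simp: inv std_gaussian_def)
    also have "measure std_gaussian \<dots> = measure (distr std_gaussian borel \<kappa>) (F -` A)"
      using FA by (intro measure_distr[symmetric]) (auto simp: \<kappa>_def std_gaussian_eq)
    finally show ?thesis by (simp add: \<kappa>_def distr_std_gaussian_reindex \<beta>)
  qed
  note this[OF d1] this[OF d2]
  ultimately show ?thesis by (simp add: card)
qed

section \<open>Velocity Verlet trajectories\<close>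

text \<open>Trapezoidal weights, in units of \<open>h\<close>, for the integral of (t - s) grad U (q
  s) over [0, t]: the node 0 counts half, and the node \<open>k\<close> has weight zero.\<close>

definition verlet_weight :: "nat \<Rightarrow> nat \<Rightarrow> real" where
  "verlet_weight k j = (if j = 0 then real k / 2 else real k - real j)"

lemma verlet_weight_nonneg: "j < k \<Longrightarrow> 0 \<le> verlet_weight k j"
  by (simp add: verlet_weight_def)

text \<open>Passing from \<open>k\<close> to \<open>Suc k\<close> raises every weight by 1, except
  the one at 0, which grows by 1/2. The two extra terms on the right are the contributions of the
  accumulated velocity and of the new half kick.\<close>

lemma verlet_weight_Suc:
  fixes G :: "nat \<Rightarrow> 'a::real_vector"
  shows "(\<Sum>j<Suc k. verlet_weight (Suc k) j *\<^sub>R G j) =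
    (\<Sum>j<k. verlet_weight k j *\<^sub>R G j) + (1/2) *\<^sub>R (\<Sum>j<k. G j + G (Suc j)) + (1/2) *\<^sub>R G k"
proof (cases k)
  case (Suc l)
  have "(\<Sum>j<Suc k. verlet_weight (Suc k) j *\<^sub>R G j) =
      (\<Sum>j<k. verlet_weight k j *\<^sub>R G j) + ((1/2) *\<^sub>R G 0 + (\<Sum>j=1..k. G j))"
  proof -
    have "(\<Sum>j<Suc k. verlet_weight (Suc k) j *\<^sub>R G j) =
      (\<Sum>j<Suc k. verlet_weight k j *\<^sub>R G j + (if j = 0 then 1/2 else 1) *\<^sub>R G j)"
      by (rule sum.cong) (auto simp: verlet_weight_def algebra_simps add_divide_distrib)
    also have "\<dots> = (\<Sum>j<Suc k. verlet_weight k j *\<^sub>R G j) + (\<Sum>j<Suc k. (if j = 0 then 1/2 else 1) *\<^sub>R G j)"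
      by (rule sum.distrib)
    also have "(\<Sum>j<Suc k. verlet_weight k j *\<^sub>R G j) = (\<Sum>j<k. verlet_weight k j *\<^sub>R G j)"
      by (simp add: verlet_weight_def)
    also have "(\<Sum>j<Suc k. (if j = 0 then 1/2 else 1) *\<^sub>R G j) = (1/2) *\<^sub>R G 0 + (\<Sum>j=1..k. G j)"
      by (simp add: sum.lessThan_Suc_shift sum.atLeast1_atMost_eq del: sum.lessThan_Suc)
    finally show ?thesis .
  qed
  moreover have "(\<Sum>j<k. G j + G (Suc j)) + G k = G 0 + 2 *\<^sub>R (\<Sum>j=1..k. G j)" for k
    by (induction k) (auto simp: algebra_simps scaleR_2)
  then have "(1/2) *\<^sub>R ((\<Sum>j<k. G j + G (Suc j)) + G k) = (1/2) *\<^sub>R (G 0 + 2 *\<^sub>R (\<Sum>j=1..k. G j))"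
    by simp
  ultimately show ?thesis by (simp add: algebra_simps)
qed (simp add: verlet_weight_def)

text \<open>The trapezoidal rule is exact for the linear function k - s.\<close>

lemma sum_verlet_weight: "(\<Sum>j<k. verlet_weight k j) = (real k)\<^sup>2 / 2"
proof (induction k)
  case (Suc k)
  then show ?case
    using verlet_weight_Suc[of k "\<lambda>_. 1::real"]
    by (simp add: power2_eq_square field_simps del: sum.lessThan_Suc)
qed simp

text \<open>Discrete variation of constants: free flight minus accumulated forces. Every later
  estimate, including those for the derivative, starts from this formula.\<close>

lemma verlet_closed_form:
  defines "q \<equiv> \<lambda>U h x v k. fst ((verlet_step U h ^^ k) (x, v))"
  shows "q U h x v k = x + (real k * h) *\<^sub>R v - h\<^sup>2 *\<^sub>R (\<Sum>j<k. verlet_weight k j *\<^sub>R grad U (q U h x v j))"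
proof -
  define w where "w k = snd ((verlet_step U h ^^ k) (x, v))" for k
  define G where "G k = grad U (q U h x v k)" for k
  have step: "q U h x v (Suc k) = q U h x v k + h *\<^sub>R w k - (h\<^sup>2 / 2) *\<^sub>R G k"
    "w (Suc k) = w k - (h / 2) *\<^sub>R (G k + G (Suc k))" for k
    by (simp_all add: q_def w_def G_def verlet_step_def Let_def case_prod_unfold)
  have w: "w k = v - (h / 2) *\<^sub>R (\<Sum>j<k. G j + G (Suc j))" for k
  proof (induction k)
    case 0 show ?case by (simp add: w_def)
  next
    case (Suc k) then show ?case by (simp add: step algebra_simps)
  qed
  show ?thesis unfolding G_def[symmetric]
  proof (induction k)
    case 0 show ?case by (simp add: q_def)
  next
    case (Suc k)
    show ?case unfolding verlet_weight_Suc step w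
      by (subst Suc.IH) (simp add: algebra_simps power2_eq_square del: sum.lessThan_Suc)
  qed
qed

text \<open>The smallness of \<open>L * T^2\<close> makes exponentials unnecessary. The weights sum
  to at most T^2 / 2 after scaling by h^2, so a bound \<open>D\<close> for all earlier terms
  reproduces itself once D = C + D / 12 + T^2 \<beta> / 2, and this is the claimed value.\<close>

lemma verlet_gronwall:
  fixes a :: "nat \<Rightarrow> real"
  assumes a: "\<And>k. k \<le> n \<Longrightarrow> a k \<le> C + h\<^sup>2 * (\<Sum>j<k. verlet_weight k j * (L * a j + \<beta>))"
    and nn: "0 \<le> C" "0 \<le> \<beta>" "0 \<le> L" "0 \<le> h" and LT: "L * (real n * h)\<^sup>2 \<le> 1 / 6"
    and k: "k \<le> n"
  shows "a k \<le> 12 / 11 * (C + (real n * h)\<^sup>2 / 2 * \<beta>)"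
  using k
proof (induction k rule: less_induct)
  case (less k)
  define D where "D = 12 / 11 * (C + (real n * h)\<^sup>2 / 2 * \<beta>)"
  have D: "D \<ge> 0" using nn by (simp add: D_def)
  have "(\<Sum>j<k. verlet_weight k j * (L * a j + \<beta>)) \<le> (\<Sum>j<k. verlet_weight k j * (L * D + \<beta>))"
    using less nn by (intro sum_mono mult_left_mono add_right_mono) (auto simp: D_def verlet_weight_nonneg)
  also have "\<dots> = (real k)\<^sup>2 / 2 * (L * D + \<beta>)"
    by (simp add: sum_verlet_weight flip: sum_distrib_right)
  finally have "h\<^sup>2 * (\<Sum>j<k. verlet_weight k j * (L * a j + \<beta>)) \<le> h\<^sup>2 * ((real k)\<^sup>2 / 2 * (L * D + \<beta>))"
    by (rule mult_left_mono) simp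
  also have "\<dots> = (real k * h)\<^sup>2 / 2 * (L * D + \<beta>)" by (simp add: power_mult_distrib)
  also have "\<dots> \<le> (real n * h)\<^sup>2 / 2 * (L * D + \<beta>)"
    using less.prems nn D by (intro mult_right_mono divide_right_mono power_mono) (auto intro: mult_right_mono)
  also have "\<dots> = (L * (real n * h)\<^sup>2) * D / 2 + (real n * h)\<^sup>2 / 2 * \<beta>" by (simp add: algebra_simps)
  also have "\<dots> \<le> 1 / 6 * D / 2 + (real n * h)\<^sup>2 / 2 * \<beta>"
    using LT D by (intro add_right_mono divide_right_mono mult_right_mono) auto
  finally have "a k \<le> C + (1 / 12 * D + (real n * h)\<^sup>2 / 2 * \<beta>)" using a[OF less.prems] by simp
  also have "\<dots> = D" by (simp add: D_def algebra_simps)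
  finally show ?case by (simp add: D_def)
qed

text \<open>\<open>H x\<close> is the Hessian as an operator; the bound on the third derivative
  enters as its Lipschitz constant \<open>L\<^sub>H\<close>.\<close>

locale verlet_smooth =
  fixes U :: "'a::euclidean_space \<Rightarrow> real" and H :: "'a \<Rightarrow> 'a \<Rightarrow> 'a"
    and L L\<^sub>H h T :: real and n :: nat
  assumes grad: "\<And>x. (grad U has_derivative H x) (at x)"
    and H_le: "\<And>x u. norm (H x u) \<le> L * norm u"
    and H_lipschitz: "\<And>x y u. norm (H x u - H y u) \<le> L\<^sub>H * norm (x - y) * norm u"
    and L: "0 \<le> L" and L\<^sub>H: "0 \<le> L\<^sub>H" and T: "0 < T" and h: "0 < h" and T_eq: "T = real n * h"
    and LT: "L * T\<^sup>2 \<le> 1 / 6"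
begin

definition pos :: "'a \<Rightarrow> 'a \<Rightarrow> nat \<Rightarrow> 'a" where
  "pos x v k = fst ((verlet_step U h ^^ k) (x, v))"

definition force_sum :: "(nat \<Rightarrow> 'a) \<Rightarrow> nat \<Rightarrow> 'a" where
  "force_sum X k = h\<^sup>2 *\<^sub>R (\<Sum>j<k. verlet_weight k j *\<^sub>R X j)"

lemma pos_eq: "pos x v k = x + (real k * h) *\<^sub>R v - force_sum (\<lambda>j. grad U (pos x v j)) k"
  unfolding pos_def force_sum_def by (rule verlet_closed_form)

lemma time_le: "k \<le> n \<Longrightarrow> real k * h \<le> T"
  unfolding T_eq using h by simp

lemma norm_force_sum_le:
  "norm (force_sum X k) \<le> h\<^sup>2 * (\<Sum>j<k. verlet_weight k j * norm (X j))"
  unfolding force_sum_def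
  by (auto intro!: mult_left_mono sum_norm_le[THEN order_trans] sum_mono simp: verlet_weight_nonneg)

lemma force_sum_diff: "force_sum X k - force_sum Y k = force_sum (\<lambda>j. X j - Y j) k"
  by (simp add: force_sum_def algebra_simps sum_subtractf)

lemma norm_force_sum_le_uniform:
  assumes "\<And>j. j < n \<Longrightarrow> norm (X j) \<le> L * B" and "0 \<le> B"
  shows "norm (force_sum X n) \<le> B / 12"
proof -
  have "norm (force_sum X n) \<le> h\<^sup>2 * (\<Sum>j<n. verlet_weight n j * norm (X j))"
    by (rule norm_force_sum_le)
  also have "\<dots> \<le> h\<^sup>2 * (\<Sum>j<n. verlet_weight n j * (L * B))"
    using assms by (intro mult_left_mono sum_mono) (auto simp: verlet_weight_nonneg)
  also have "\<dots> = L * T\<^sup>2 * B / 2"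
    by (simp add: sum_verlet_weight T_eq power_mult_distrib flip: sum_distrib_right)
  also have "\<dots> \<le> 1 / 6 * B / 2"
    using LT assms(2) by (intro divide_right_mono mult_right_mono) auto
  finally show ?thesis by simp
qed

lemma gronwall:
  assumes "\<And>k. k \<le> n \<Longrightarrow> a k \<le> C + h\<^sup>2 * (\<Sum>j<k. verlet_weight k j * (L * a j + \<beta>))"
    and "0 \<le> C" "0 \<le> \<beta>" "k \<le> n"
  shows "a k \<le> 12 / 11 * (C + T\<^sup>2 / 2 * \<beta>)"
  unfolding T_eq using assms L h LT by (intro verlet_gronwall[where L = L]) (auto simp: T_eq)

lemma grad_lipschitz: "norm (grad U x - grad U y) \<le> L * norm (x - y)"
  by (rule differentiable_bound[of UNIV _ H]) (auto intro: grad onorm_le H_le)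

lemma pos_dist_le:
  assumes k: "k \<le> n"
  shows "norm (pos x v k - pos y w k) \<le> 12 / 11 * (norm (x - y) + T * norm (v - w))"
proof -
  have "norm (pos x v k - pos y w k) \<le> (norm (x - y) + T * norm (v - w)) +
      h\<^sup>2 * (\<Sum>j<k. verlet_weight k j * (L * norm (pos x v j - pos y w j) + 0))" if k: "k \<le> n" for k
  proof -
    have "pos x v k - pos y w k = (x - y) + (real k * h) *\<^sub>R (v - w) -
        force_sum (\<lambda>j. grad U (pos x v j) - grad U (pos y w j)) k"
      unfolding force_sum_diff[symmetric] by (subst (1 2) pos_eq) (simp add: algebra_simps)
    also have "norm \<dots> \<le> norm (x - y) + norm ((real k * h) *\<^sub>R (v - w)) +
        norm (force_sum (\<lambda>j. grad U (pos x v j) - grad U (pos y w j)) k)"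
      by (rule norm_triangle_le_diff) (intro add_right_mono norm_triangle_ineq)
    also have "\<dots> \<le> norm (x - y) + T * norm (v - w) +
        h\<^sup>2 * (\<Sum>j<k. verlet_weight k j * norm (grad U (pos x v j) - grad U (pos y w j)))"
      using time_le[OF k] h by (intro add_mono norm_force_sum_le) (auto intro!: mult_right_mono)
    also have "\<dots> \<le> norm (x - y) + T * norm (v - w) +
        h\<^sup>2 * (\<Sum>j<k. verlet_weight k j * (L * norm (pos x v j - pos y w j)))"
      by (intro add_left_mono mult_left_mono sum_mono grad_lipschitz) (auto simp: verlet_weight_nonneg)
    finally show ?thesis by simp
  qed
  from gronwall[OF this _ _ k] T show ?thesis by simp
qed

text \<open>Equal endpoints turn the closed form into T (v - w) = S - (x - y), where S is at most
  1/11 of |x - y| + T |v - w|. Absorbing the velocity term leaves 12/11 divided by 10/11, that is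
  6/5.\<close>

lemma pos_eq_imp_velocity_dist_le:
  assumes "pos x v n = pos y w n"
  shows "norm (v - w) \<le> 6 / 5 * norm (x - y) / T"
proof -
  define S where "S = force_sum (\<lambda>j. grad U (pos x v j) - grad U (pos y w j)) n"
  define B where "B = 12 / 11 * (norm (x - y) + T * norm (v - w))"
  have "norm (grad U (pos x v j) - grad U (pos y w j)) \<le> L * B" if "j < n" for j
    unfolding B_def using pos_dist_le[of j x v y w] that L
    by (intro order_trans[OF grad_lipschitz] mult_left_mono) auto
  then have S: "norm S \<le> B / 12"
    unfolding S_def using T by (intro norm_force_sum_le_uniform) (auto simp: B_def)
  have "T *\<^sub>R (v - w) = S - (x - y)"
    using assms unfolding S_def force_sum_diff[symmetric] T_eq
    by (subst (asm) (1 2) pos_eq) (simp add: algebra_simps)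
  then have "T * norm (v - w) = norm (S - (x - y))"
    using T by (metis abs_of_pos norm_scaleR)
  also have "\<dots> \<le> norm S + norm (x - y)" by (rule norm_triangle_ineq4)
  finally have "T * norm (v - w) \<le> 6 / 5 * norm (x - y)" using S by (simp add: B_def)
  then show ?thesis using T by (simp add: field_simps)
qed

section \<open>Derivative of the position in the initial velocity\<close>

definition dpos :: "'a \<Rightarrow> 'a \<Rightarrow> nat \<Rightarrow> 'a \<Rightarrow> 'a" where
  "dpos x v k = frechet_derivative (\<lambda>v. pos x v k) (at v)"

text \<open>The force sum at \<open>k\<close> involves strictly earlier positions only, so
  differentiability follows by strong induction, and the derivative obeys the linearised closed
  form.\<close>

lemma pos_has_derivative_aux:
  assumes "\<And>j. j < k \<Longrightarrow> ((\<lambda>v. pos x v j) has_derivative J j) (at v)"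
  shows "((\<lambda>v. pos x v k) has_derivative
    (\<lambda>u. (real k * h) *\<^sub>R u - force_sum (\<lambda>j. H (pos x v j) (J j u)) k)) (at v)"
proof -
  have "((\<lambda>v. grad U (pos x v j)) has_derivative (\<lambda>u. H (pos x v j) (J j u))) (at v)" if "j < k" for j
    using has_derivative_compose[OF assms[OF that] grad] .
  then show ?thesis
    unfolding force_sum_def
    by (subst pos_eq[abs_def], unfold force_sum_def) (auto intro!: derivative_eq_intros)
qed

lemma pos_has_derivative: "((\<lambda>v. pos x v k) has_derivative dpos x v k) (at v)"
proof (induction k rule: less_induct)
  case (less k)
  from pos_has_derivative_aux[OF this] show ?case
    unfolding dpos_def using frechet_derivative_works differentiableI by blast
qed

lemma dpos_eq: "dpos x v k u = (real k * h) *\<^sub>R u - force_sum (\<lambda>j. H (pos x v j) (dpos x v j u)) k"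
  using has_derivative_unique[OF pos_has_derivative pos_has_derivative_aux[OF pos_has_derivative]]
  by meson

lemma norm_dpos_le:
  assumes k: "k \<le> n"
  shows "norm (dpos x v k u) \<le> 12 / 11 * (T * norm u)"
proof -
  have "norm (dpos x v k u) \<le> T * norm u + h\<^sup>2 * (\<Sum>j<k. verlet_weight k j * (L * norm (dpos x v j u) + 0))"
    if k: "k \<le> n" for k
  proof -
    have "norm (dpos x v k u) \<le> norm ((real k * h) *\<^sub>R u) + norm (force_sum (\<lambda>j. H (pos x v j) (dpos x v j u)) k)"
      by (subst dpos_eq) (rule norm_triangle_ineq4)
    also have "\<dots> \<le> T * norm u + h\<^sup>2 * (\<Sum>j<k. verlet_weight k j * norm (H (pos x v j) (dpos x v j u)))"
      using time_le[OF k] h by (intro add_mono norm_force_sum_le) (auto intro!: mult_right_mono)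
    also have "\<dots> \<le> T * norm u + h\<^sup>2 * (\<Sum>j<k. verlet_weight k j * (L * norm (dpos x v j u)))"
      by (intro add_left_mono mult_left_mono sum_mono H_le) (auto simp: verlet_weight_nonneg)
    finally show ?thesis by simp
  qed
  from gronwall[OF this _ _ k] T show ?thesis by simp
qed

text \<open>The forces contribute 12/11 times 1/12, that is 1/11, rounded up to 1/10.\<close>

lemma dpos_near_scaling: "norm (dpos x v n u - T *\<^sub>R u) \<le> 1 / 10 * T * norm u"
proof -
  have "norm (H (pos x v j) (dpos x v j u)) \<le> L * (12 / 11 * (T * norm u))" if "j < n" for j
    using norm_dpos_le[of j x v u] that L by (intro order_trans[OF H_le] mult_left_mono) auto
  then have "norm (force_sum (\<lambda>j. H (pos x v j) (dpos x v j u)) n) \<le> 12 / 11 * (T * norm u) / 12"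
    using T by (intro norm_force_sum_le_uniform) auto
  moreover have "norm (dpos x v n u - T *\<^sub>R u) = norm (force_sum (\<lambda>j. H (pos x v j) (dpos x v j u)) n)"
    by (subst dpos_eq) (simp add: T_eq)
  moreover have "0 \<le> T * norm u" using T by simp
  ultimately show ?thesis by (simp add: algebra_simps)
qed

lemma dpos_dist_le:
  assumes eq: "pos x v n = pos y w n"
  shows "norm (dpos x v n u - dpos y w n u) \<le> 2 * L\<^sub>H * T ^ 3 * norm (x - y) * norm u"
proof -
  \<comment> \<open>12/5 is 12/11 times 1 + 6/5: the distance of trajectories with a common
    endpoint, the velocity difference having been eliminated.\<close>
  define D where "D = 12 / 5 * norm (x - y)"
  define \<beta> where "\<beta> = L\<^sub>H * D * (12 / 11 * (T * norm u))"
  have "T * norm (v - w) \<le> 6 / 5 * norm (x - y)"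
    using pos_eq_imp_velocity_dist_le[OF eq] T by (simp add: field_simps)
  then have D: "norm (pos x v j - pos y w j) \<le> D" if "j \<le> n" for j
    using pos_dist_le[OF that, of x v y w] by (simp add: D_def)
  have D0: "0 \<le> D" by (simp add: D_def)
  have \<beta>0: "0 \<le> \<beta>" using L\<^sub>H T D0 by (simp add: \<beta>_def)
  \<comment> \<open>The Hessian applied to the difference of derivatives feeds the recursion; the
    difference of the Hessians along the two trajectories is the source term \<beta>.\<close>
  have H_diff: "norm (H (pos x v j) (dpos x v j u) - H (pos y w j) (dpos y w j u))
      \<le> L * norm (dpos x v j u - dpos y w j u) + \<beta>" if j: "j \<le> n" for j
  proof -
    have lin: "linear (H (pos y w j))" using grad has_derivative_linear by blast
    have "H (pos x v j) (dpos x v j u) - H (pos y w j) (dpos y w j u) =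
        H (pos y w j) (dpos x v j u - dpos y w j u) +
        (H (pos x v j) (dpos x v j u) - H (pos y w j) (dpos x v j u))"
      by (simp add: linear_diff[OF lin])
    also have "norm \<dots> \<le> L * norm (dpos x v j u - dpos y w j u) +
        L\<^sub>H * norm (pos x v j - pos y w j) * norm (dpos x v j u)"
      by (rule norm_triangle_le) (intro add_mono H_le H_lipschitz)
    also have "L\<^sub>H * norm (pos x v j - pos y w j) * norm (dpos x v j u) \<le> \<beta>"
      unfolding \<beta>_def using D[OF j] norm_dpos_le[OF j, of x v u] L\<^sub>H D0 by (intro mult_mono) auto
    finally show ?thesis by simp
  qed
  have "norm (dpos x v k u - dpos y w k u) \<le> 0 +
      h\<^sup>2 * (\<Sum>j<k. verlet_weight k j * (L * norm (dpos x v j u - dpos y w j u) + \<beta>))" if k: "k \<le> n" for k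
  proof -
    have "dpos x v k u - dpos y w k u =
        - force_sum (\<lambda>j. H (pos x v j) (dpos x v j u) - H (pos y w j) (dpos y w j u)) k"
      unfolding force_sum_diff[symmetric] by (subst (1 2) dpos_eq) simp
    then have "norm (dpos x v k u - dpos y w k u) \<le>
        h\<^sup>2 * (\<Sum>j<k. verlet_weight k j * norm (H (pos x v j) (dpos x v j u) - H (pos y w j) (dpos y w j u)))"
      by (simp add: norm_force_sum_le)
    also have "\<dots> \<le> h\<^sup>2 * (\<Sum>j<k. verlet_weight k j * (L * norm (dpos x v j u - dpos y w j u) + \<beta>))"
      using k by (intro mult_left_mono sum_mono H_diff) (auto simp: verlet_weight_nonneg)
    finally show ?thesis by simp
  qed
  from gronwall[OF this _ \<beta>0 order.refl]
  have "norm (dpos x v n u - dpos y w n u) \<le> 12 / 11 * (T\<^sup>2 / 2 * \<beta>)" by simp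
  also have "\<dots> = 12 / 11 * 6 / 11 * 12 / 5 * (L\<^sub>H * T ^ 3 * norm (x - y) * norm u)"
    by (simp add: \<beta>_def D_def power2_eq_square power3_eq_cube)
  also have "\<dots> \<le> 2 * (L\<^sub>H * T ^ 3 * norm (x - y) * norm u)"
    using L\<^sub>H T by (intro mult_right_mono) auto
  finally show ?thesis by (simp add: mult.assoc)
qed

end

section \<open>The transition kernel\<close>

definition riesz :: "('a::euclidean_space \<Rightarrow>\<^sub>L real) \<Rightarrow> 'a" where
  "riesz f = (\<Sum>b\<in>Basis. blinfun_apply f b *\<^sub>R b)"

lemma inner_riesz: "u \<bullet> riesz f = blinfun_apply f u"
proof -
  have "blinfun_apply f u = blinfun_apply f (\<Sum>b\<in>Basis. (u \<bullet> b) *\<^sub>R b)"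
    by (simp add: euclidean_representation)
  also have "\<dots> = (\<Sum>b\<in>Basis. (u \<bullet> b) * blinfun_apply f b)"
    by (simp add: blinfun.sum_right blinfun.scaleR_right)
  finally show ?thesis by (simp add: riesz_def inner_sum_right mult.commute)
qed

lemma norm_riesz_le: "norm (riesz f) \<le> norm f"
proof (cases "riesz f = 0")
  case False
  have "(norm (riesz f))\<^sup>2 = blinfun_apply f (riesz f)"
    by (simp add: power2_norm_eq_inner inner_riesz)
  also have "\<dots> \<le> norm f * norm (riesz f)"
    using norm_blinfun[of f "riesz f"] by simp
  finally show ?thesis using False by (simp add: power2_eq_square)
qed simp

lemma riesz_diff: "riesz (f - g) = riesz f - riesz g"
  by (simp add: riesz_def blinfun.diff_left algebra_simps sum_subtractf)

lemma bounded_linear_riesz: "bounded_linear riesz"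
  by (rule bounded_linear_intro[of _ 1])
     (simp_all add: riesz_def blinfun.add_left blinfun.scaleR_left scaleR_left_distrib sum.distrib
       scaleR_sum_right norm_riesz_le[unfolded riesz_def])

lemma grad_eq_riesz:
  assumes "U differentiable (at x)"
  shows "grad U x = riesz (fderiv U x)"
  unfolding grad_def
proof (rule the_equality)
  have d: "(U has_derivative (\<lambda>u. u \<bullet> riesz (fderiv U x))) (at x)"
    using blinfun_apply_fderiv[OF assms] by (simp add: inner_riesz)
  then show "GDERIV U x :> riesz (fderiv U x)" by (simp add: gderiv_def)
  fix g assume "GDERIV U x :> g"
  then have "(U has_derivative (\<lambda>u. u \<bullet> g)) (at x)" by (simp add: gderiv_def)
  from has_derivative_unique[OF this d] show "g = riesz (fderiv U x)"
    by (metis inner_commute vector_eq_ldot)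
qed

text \<open>Riesz representation is linear and does not increase norms, so the bounds on the second
  and third derivative pass to the Hessian operator, the latter through the mean value
  theorem.\<close>

lemma verlet_smoothI:
  fixes U :: "'a::euclidean_space \<Rightarrow> real"
  assumes C4: "C4 U"
    and bdd2: "bdd_above (range (\<lambda>x. norm (D2 U x)))" and bdd3: "bdd_above (range (\<lambda>x. norm (D3 U x)))"
    and T: "T > 0" and h: "h > 0" and T_eq: "T = real n * h"
    and LT: "(SUP x. norm (D2 U x)) * T\<^sup>2 \<le> 1 / 6"
  shows "verlet_smooth U (\<lambda>x u. riesz (blinfun_apply (D2 U x) u))
    (SUP x. norm (D2 U x)) (SUP x. norm (D3 U x)) h T n"
proof
  have D2_le: "norm (D2 U x) \<le> (SUP x. norm (D2 U x))" for x
    by (rule cSUP_upper[OF _ bdd2]) simp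
  have D3_le: "norm (D3 U x) \<le> (SUP x. norm (D3 U x))" for x
    by (rule cSUP_upper[OF _ bdd3]) simp
  show "0 \<le> (SUP x. norm (D2 U x))" using D2_le[of 0] norm_ge_zero order_trans by blast
  show "0 \<le> (SUP x. norm (D3 U x))" using D3_le[of 0] norm_ge_zero order_trans by blast
  fix x y u :: 'a
  have "(fderiv U has_derivative blinfun_apply (D2 U x)) (at x)"
    unfolding D2_def using C4 by (intro blinfun_apply_fderiv) (simp add: C4_def)
  note bounded_linear.has_derivative[OF bounded_linear_riesz this]
  moreover have "grad U = (\<lambda>x. riesz (fderiv U x))"
    using C4 by (intro ext grad_eq_riesz) (simp add: C4_def)
  ultimately
  show "(grad U has_derivative (\<lambda>u. riesz (blinfun_apply (D2 U x) u))) (at x)"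
    by simp
  show "norm (riesz (blinfun_apply (D2 U x) u)) \<le> (SUP x. norm (D2 U x)) * norm u"
    by (rule order_trans[OF norm_riesz_le], rule order_trans[OF norm_blinfun])
       (intro mult_right_mono D2_le norm_ge_zero)
  have lip: "norm (D2 U x - D2 U y) \<le> (SUP x. norm (D3 U x)) * norm (x - y)"
  proof (rule differentiable_bound[of UNIV])
    fix z :: 'a
    show "(D2 U has_derivative blinfun_apply (D3 U z)) (at z)"
      unfolding D3_def using C4 by (intro blinfun_apply_fderiv) (simp add: C4_def)
    show "onorm (blinfun_apply (D3 U z)) \<le> (SUP x. norm (D3 U x))"
      using D3_le[of z] by (simp add: norm_blinfun.rep_eq)
  qed auto
  have "norm (riesz (blinfun_apply (D2 U x) u) - riesz (blinfun_apply (D2 U y) u))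
      \<le> norm (blinfun_apply (D2 U x - D2 U y) u)"
    unfolding riesz_diff[symmetric] blinfun.diff_left by (rule norm_riesz_le)
  also have "\<dots> \<le> norm (D2 U x - D2 U y) * norm u" by (rule norm_blinfun)
  also have "\<dots> \<le> (SUP x. norm (D3 U x)) * norm (x - y) * norm u"
    by (intro mult_right_mono lip norm_ge_zero)
  finally show "norm (riesz (blinfun_apply (D2 U x) u) - riesz (blinfun_apply (D2 U y) u))
    \<le> (SUP x. norm (D3 U x)) * norm (x - y) * norm u" .
qed (use assms in auto)

section \<open>Measurability and smoothing of the kernel\<close>

lemma (in verlet_smooth) verlet_pos_eq: "verlet_pos U h T x v = pos x v n"
  using h by (simp add: verlet_pos_def pos_def T_eq)

lemma (in verlet_smooth) continuous_grad: "continuous_on UNIV (grad U)"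
  using grad by (auto intro!: has_derivative_continuous_on intro: has_derivative_at_withinI)

lemma (in verlet_smooth) continuous_pos: "continuous_on UNIV (\<lambda>p. pos (fst p) (snd p) k)"
proof -
  have step: "continuous_on UNIV (verlet_step U h)"
    unfolding verlet_step_def case_prod_unfold Let_def
    by (intro continuous_intros continuous_on_compose2[OF continuous_grad]) auto
  have "continuous_on UNIV (verlet_step U h ^^ k)"
    by (induction k) (auto intro: continuous_on_compose2[OF step] simp: o_def)
  then show ?thesis unfolding pos_def by (simp add: continuous_on_fst)
qed

lemma (in verlet_smooth) uhmc_kernel_measurable: "uhmc_kernel U T h \<in> borel \<rightarrow>\<^sub>M prob_algebra borel"
proof -
  have "(\<lambda>p. verlet_pos U h T (fst p) (snd p)) \<in> borel_measurable (borel \<Otimes>\<^sub>M borel)"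
    unfolding verlet_pos_eq borel_prod by (rule borel_measurable_continuous_onI[OF continuous_pos])
  then have "(\<lambda>(x, v). verlet_pos U h T x v) \<in> borel \<Otimes>\<^sub>M (std_gaussian :: 'a measure) \<rightarrow>\<^sub>M borel"
    by (simp add: case_prod_unfold std_gaussian_def cong: measurable_cong_sets)
  moreover have "(\<lambda>x. std_gaussian) \<in> borel \<rightarrow>\<^sub>M prob_algebra (std_gaussian :: 'a measure)"
    by (rule measurable_const) (simp add: space_prob_algebra prob_space_std_gaussian)
  ultimately show ?thesis
    unfolding uhmc_kernel_def[abs_def] by (intro measurable_distr_prob_space2)
qed

lemma uhmc_kernel_dist_le:
  fixes U :: "real^'n \<Rightarrow> real"
  assumes vs: "verlet_smooth U H L L\<^sub>H h T n" and A: "A \<in> sets borel"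
  shows "\<bar>measure (uhmc_kernel U T h x) A - measure (uhmc_kernel U T h y) A\<bar>
    \<le> 3 / 2 * sqrt (1 / T\<^sup>2 + 27 * real CARD('n) * L\<^sub>H\<^sup>2 * T ^ 4) * norm (x - y)"
\<comment> \<open>The case is split off because \<open>pushforward_gaussian_dist\<close> needs a
  positive \<rho>, here 6/5 |x - y| / T.\<close>
proof (cases "x = y")
  case False
  interpret verlet_smooth U H L L\<^sub>H h T n by (rule vs)
  have meas: "measure (uhmc_kernel U T h z) A = measure std_gaussian ((\<lambda>v. pos z v n) -` A)" for z
  proof -
    have "continuous_on UNIV (\<lambda>v. pos z v n)"
      using continuous_on_compose2[OF continuous_pos[of n], of UNIV "\<lambda>v. (z, v)"] by (simp add: continuous_on_Pair)
    then have "(\<lambda>v. pos z v n) \<in> borel_measurable std_gaussian"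
      by (simp add: std_gaussian_def borel_measurable_continuous_onI)
    then show ?thesis
      unfolding uhmc_kernel_def verlet_pos_eq using A by (simp add: measure_distr) (simp add: std_gaussian_def)
  qed
  define r where "r = norm (x - y)"
  have r: "r > 0" using False by (simp add: r_def)
  have "\<bar>measure (uhmc_kernel U T h x) A - measure (uhmc_kernel U T h y) A\<bar>
      \<le> sqrt ((6 / 5 * r / T)\<^sup>2 / 4 + 2 * real CARD('n) * ((2 * L\<^sub>H * T ^ 3 * r) / T)\<^sup>2)"
    unfolding meas r_def
    by (rule pushforward_gaussian_dist[OF T pos_has_derivative pos_has_derivative dpos_near_scaling
          dpos_near_scaling _ pos_eq_imp_velocity_dist_le _ dpos_dist_le A])
       (use T L\<^sub>H r in \<open>auto simp: r_def\<close>)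
  \<comment> \<open>The two coefficients obtained are 9/25 and 8; the stated ones are 9/4 and 27
    times 9/4.\<close>
  also have "\<dots> \<le> sqrt ((3 / 2)\<^sup>2 * (1 / T\<^sup>2 + 27 * real CARD('n) * L\<^sub>H\<^sup>2 * T ^ 4) * r\<^sup>2)"
  proof (rule real_sqrt_le_mono)
    have e1: "(6 / 5 * r / T)\<^sup>2 / 4 = 9 / 25 * (1 / T\<^sup>2 * r\<^sup>2)"
      by (simp add: power_divide power_mult_distrib)
    have e2: "2 * real CARD('n) * ((2 * L\<^sub>H * T ^ 3 * r) / T)\<^sup>2 = 8 * (real CARD('n) * L\<^sub>H\<^sup>2 * T ^ 4 * r\<^sup>2)"
      using T by (simp add: power_divide power_mult_distrib field_simps flip: power_add power_mult)
    have "9 / 25 * (1 / T\<^sup>2 * r\<^sup>2) \<le> 9 / 4 * (1 / T\<^sup>2 * r\<^sup>2)"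
      "8 * (real CARD('n) * L\<^sub>H\<^sup>2 * T ^ 4 * r\<^sup>2) \<le> 243 / 4 * (real CARD('n) * L\<^sub>H\<^sup>2 * T ^ 4 * r\<^sup>2)"
      by (intro mult_right_mono; simp)+
    moreover have "(3 / 2)\<^sup>2 * (1 / T\<^sup>2 + 27 * real CARD('n) * L\<^sub>H\<^sup>2 * T ^ 4) * r\<^sup>2 =
        9 / 4 * (1 / T\<^sup>2 * r\<^sup>2) + 243 / 4 * (real CARD('n) * L\<^sub>H\<^sup>2 * T ^ 4 * r\<^sup>2)"
      by (simp add: power2_eq_square[of "3/2::real"] algebra_simps)
    ultimately show "(6 / 5 * r / T)\<^sup>2 / 4 + 2 * real CARD('n) * ((2 * L\<^sub>H * T ^ 3 * r) / T)\<^sup>2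
        \<le> (3 / 2)\<^sup>2 * (1 / T\<^sup>2 + 27 * real CARD('n) * L\<^sub>H\<^sup>2 * T ^ 4) * r\<^sup>2"
      unfolding e1 e2 by linarith
  qed
  also have "\<dots> = 3 / 2 * sqrt (1 / T\<^sup>2 + 27 * real CARD('n) * L\<^sub>H\<^sup>2 * T ^ 4) * r"
    using r by (simp add: real_sqrt_mult)
  finally show ?thesis by (simp add: r_def)
qed simp

section \<open>Kernels acting on measures, couplings and total variation\<close>

lemma borel_prob_iff: "borel_prob \<nu> \<longleftrightarrow> \<nu> \<in> space (prob_algebra borel)"
  by (auto simp: borel_prob_def space_prob_algebra)

lemma kernel_power_measurable:
  assumes "K \<in> borel \<rightarrow>\<^sub>M prob_algebra borel"
  shows "kernel_power K m \<in> borel \<rightarrow>\<^sub>M prob_algebra borel"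
proof (induction m)
  case 0
  have "kernel_power K 0 = return borel" by (simp add: fun_eq_iff)
  then show ?case by (simp add: measurable_return_prob_space)
next
  case (Suc m)
  have "kernel_power K (Suc m) = (\<lambda>x. kernel_power K m x \<bind> K)" by (simp add: fun_eq_iff)
  then show ?case using measurable_bind_prob_space[OF Suc assms] by simp
qed

lemma borel_prob_bind:
  assumes "borel_prob \<nu>" and "K \<in> borel \<rightarrow>\<^sub>M prob_algebra borel"
  shows "borel_prob (\<nu> \<bind> K)"
proof -
  have "(\<lambda>_::unit. \<nu>) \<in> count_space UNIV \<rightarrow>\<^sub>M prob_algebra borel"
    using assms(1) by (simp add: borel_prob_iff)
  from measurable_space[OF measurable_bind_prob_space[OF this assms(2)], of "()"]
  show ?thesis by (simp add: borel_prob_iff)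
qed

lemma bind_kernel_power_Suc:
  assumes \<nu>: "sets \<nu> = sets borel" and K: "K \<in> borel \<rightarrow>\<^sub>M prob_algebra borel"
  shows "\<nu> \<bind> kernel_power K (Suc m) = (\<nu> \<bind> kernel_power K m) \<bind> K"
proof -
  have "kernel_power K m \<in> \<nu> \<rightarrow>\<^sub>M subprob_algebra borel"
    using measurable_prob_algebraD[OF kernel_power_measurable[OF K]] \<nu> by (simp cong: measurable_cong_sets)
  from bind_assoc[OF this measurable_prob_algebraD[OF K]] show ?thesis
    by (simp cong: bind_cong)
qed

lemma W1_commute_le: "W1 \<nu> \<eta> \<le> W1 \<eta> \<nu>"
  unfolding W1_def
proof (rule INF_greatest)
  fix \<gamma> :: "('a \<times> 'a) measure" assume "\<gamma> \<in> couplings \<eta> \<nu>"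
  then have \<gamma>: "prob_space \<gamma>" and sets [measurable_cong]: "sets \<gamma> = sets (borel \<Otimes>\<^sub>M borel)"
    and marg: "distr \<gamma> borel fst = \<eta>" "distr \<gamma> borel snd = \<nu>"
    by (auto simp: couplings_def)
  define \<gamma>' where "\<gamma>' = distr \<gamma> (borel \<Otimes>\<^sub>M borel) (\<lambda>z. (snd z, fst z))"
  have "prob_space \<gamma>'"
    unfolding \<gamma>'_def by (rule prob_space.prob_space_distr[OF \<gamma>]) measurable
  then have mem: "\<gamma>' \<in> couplings \<nu> \<eta>"
    unfolding couplings_def \<gamma>'_def using marg by (auto simp: distr_distr o_def)
  have eq: "(\<integral>\<^sup>+z. ennreal (norm (fst z - snd z)) \<partial>\<gamma>') = (\<integral>\<^sup>+z. ennreal (norm (fst z - snd z)) \<partial>\<gamma>)"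
    unfolding \<gamma>'_def by (simp add: nn_integral_distr norm_minus_commute)
  show "(INF \<gamma>\<in>couplings \<nu> \<eta>. \<integral>\<^sup>+z. ennreal (norm (fst z - snd z)) \<partial>\<gamma>)
      \<le> (\<integral>\<^sup>+z. ennreal (norm (fst z - snd z)) \<partial>\<gamma>)"
    using INF_lower[OF mem, of "\<lambda>\<gamma>. \<integral>\<^sup>+z. ennreal (norm (fst z - snd z)) \<partial>\<gamma>"] unfolding eq .
qed

text \<open>The contraction (A5) has the invariant measure as second argument, the claim has it as
  first.\<close>

lemma W1_commute: "W1 \<nu> \<eta> = W1 \<eta> \<nu>"
  by (intro antisym W1_commute_le)

text \<open>Along any coupling the difference of the two image measures of \<open>A\<close> is the
  integral of the difference of the kernels, which the Lipschitz bound controls; the estimate is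
  uniform in \<open>A\<close>.\<close>

lemma TV_bind_le_W1:
  fixes K :: "'a::euclidean_space \<Rightarrow> 'a measure"
  assumes K: "K \<in> borel \<rightarrow>\<^sub>M prob_algebra borel" and C: "C > 0"
    and lip: "\<And>A x y. A \<in> sets borel \<Longrightarrow> \<bar>measure (K x) A - measure (K y) A\<bar> \<le> C * norm (x - y)"
    and \<mu>: "borel_prob \<mu>" and \<nu>: "borel_prob \<nu>"
  shows "ennreal (TV (\<mu> \<bind> K) (\<nu> \<bind> K)) \<le> ennreal C * W1 \<mu> \<nu>"
proof -
  have K' [measurable]: "K \<in> borel \<rightarrow>\<^sub>M subprob_algebra borel" by (rule measurable_prob_algebraD[OF K])
  have bind: "measure (\<eta> \<bind> K) A = (\<integral>x. measure (K x) A \<partial>\<eta>)" if \<eta>: "borel_prob \<eta>" and A: "A \<in> sets borel" for \<eta> A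
  proof -
    interpret prob_space \<eta> using \<eta> by (simp add: borel_prob_def)
    have "K \<in> \<eta> \<rightarrow>\<^sub>M subprob_algebra borel"
      using K' \<eta> by (simp add: borel_prob_def cong: measurable_cong_sets)
    from measure_bind[OF this A] show ?thesis .
  qed
  have le: "ennreal (TV (\<mu> \<bind> K) (\<nu> \<bind> K)) \<le> ennreal C * (\<integral>\<^sup>+z. ennreal (norm (fst z - snd z)) \<partial>\<gamma>)"
    if "\<gamma> \<in> couplings \<mu> \<nu>" for \<gamma>
  proof -
    have \<gamma>: "prob_space \<gamma>" and sets [measurable_cong]: "sets \<gamma> = sets (borel \<Otimes>\<^sub>M borel)"
      and marg: "distr \<gamma> borel fst = \<mu>" "distr \<gamma> borel snd = \<nu>"
      using that by (auto simp: couplings_def)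
    interpret \<gamma>: prob_space \<gamma> by (rule \<gamma>)
    define R where "R = ennreal C * (\<integral>\<^sup>+z. ennreal (norm (fst z - snd z)) \<partial>\<gamma>)"
    have *: "ennreal \<bar>measure (\<mu> \<bind> K) A - measure (\<nu> \<bind> K) A\<bar> \<le> R" if A [measurable]: "A \<in> sets borel" for A
    proof -
      have f [measurable]: "(\<lambda>x. measure (K x) A) \<in> borel_measurable borel" by measurable
      have le1: "measure (K x) A \<le> 1" for x
        using measurable_space[OF K, of x] by (simp add: space_prob_algebra prob_space.prob_le_1)
      have int: "integrable \<gamma> (\<lambda>z. measure (K (fst z)) A)" "integrable \<gamma> (\<lambda>z. measure (K (snd z)) A)"
        by (auto intro!: \<gamma>.integrable_const_bound[of _ 1] simp: le1)
      have "measure (\<mu> \<bind> K) A = (\<integral>z. measure (K (fst z)) A \<partial>\<gamma>)"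
        unfolding bind[OF \<mu> A] by (subst marg(1)[symmetric], rule integral_distr) auto
      moreover have "measure (\<nu> \<bind> K) A = (\<integral>z. measure (K (snd z)) A \<partial>\<gamma>)"
        unfolding bind[OF \<nu> A] by (subst marg(2)[symmetric], rule integral_distr) auto
      ultimately have "measure (\<mu> \<bind> K) A - measure (\<nu> \<bind> K) A =
          (\<integral>z. measure (K (fst z)) A - measure (K (snd z)) A \<partial>\<gamma>)"
        using int by simp
      then have "ennreal \<bar>measure (\<mu> \<bind> K) A - measure (\<nu> \<bind> K) A\<bar> \<le>
          (\<integral>\<^sup>+z. ennreal \<bar>measure (K (fst z)) A - measure (K (snd z)) A\<bar> \<partial>\<gamma>)"
        using integral_norm_bound_ennreal[of \<gamma> "\<lambda>z. measure (K (fst z)) A - measure (K (snd z)) A"] int by simp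
      also have "\<dots> \<le> (\<integral>\<^sup>+z. ennreal C * ennreal (norm (fst z - snd z)) \<partial>\<gamma>)"
        using lip[OF A] C by (intro nn_integral_mono) (simp flip: ennreal_mult)
      also have "\<dots> = R" unfolding R_def by (rule nn_integral_cmult) measurable
      finally show ?thesis .
    qed
    show ?thesis
    proof (cases R)
      case (real B)
      have "TV (\<mu> \<bind> K) (\<nu> \<bind> K) \<le> B"
        unfolding TV_def using * real by (intro cSUP_least) (auto simp: ennreal_le_iff)
      then show ?thesis using real by (simp add: R_def ennreal_leI)
    qed (simp add: R_def)
  qed
  \<comment> \<open>Moving \<open>C\<close> to the left leaves a bare infimum on the right, so that
    a bound for each single coupling suffices.\<close>
  have "ennreal (1 / C) * ennreal (TV (\<mu> \<bind> K) (\<nu> \<bind> K)) \<le> W1 \<mu> \<nu>"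
    unfolding W1_def
  proof (rule INF_greatest)
    fix \<gamma> assume "\<gamma> \<in> couplings \<mu> \<nu>"
    from mult_left_mono[OF le[OF this], of "ennreal (1 / C)"]
    show "ennreal (1 / C) * ennreal (TV (\<mu> \<bind> K) (\<nu> \<bind> K)) \<le> (\<integral>\<^sup>+z. ennreal (norm (fst z - snd z)) \<partial>\<gamma>)"
      using C by (simp add: mult.assoc[symmetric] ennreal_mult[symmetric])
  qed
  from mult_left_mono[OF this, of "ennreal C"] show ?thesis
    using C by (simp add: mult.assoc[symmetric] ennreal_mult[symmetric])
qed

theorem theorem5:
  fixes U :: "real ^ 'n \<Rightarrow> real"
    and L L\<^sub>H L\<^sub>I T h M\<^sub>1 M\<^sub>2 c :: real
    and \<mu>' :: "(real ^ 'n) measure"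
  assumes "C4 U"
    and "integrable lborel (\<lambda>x. exp (- U x))"
    and "\<forall>x. U 0 \<le> U x" and "U 0 = 0"
    and "bdd_above (range (\<lambda>x. norm (D2 U x)))" and "L = (SUP x. norm (D2 U x))"
    and "bdd_above (range (\<lambda>x. norm (D3 U x)))" and "L\<^sub>H = (SUP x. norm (D3 U x))"
    and "bdd_above (range (\<lambda>x. norm (D4 U x)))" and "L\<^sub>I = (SUP x. norm (D4 U x))"
    and "T > 0" and "h > 0" and "T / h \<in> \<nat>" and "L * (T\<^sup>2 + T * h) \<le> 1 / 6"
    and "borel_prob \<mu>'" and "\<mu>' \<bind> uhmc_kernel U T h = \<mu>'"
    and "M\<^sub>1 > 0" and "c > 0"
    and A5: "\<forall>(m::nat) \<nu>. borel_prob \<nu> \<longrightarrow>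
      W1 (\<nu> \<bind> kernel_power (uhmc_kernel U T h) m) \<mu>' \<le> ennreal (M\<^sub>1 * exp (- c * real m)) * W1 \<nu> \<mu>'"
    and "M\<^sub>2 > 0"
    and A6: "W1 (target U) \<mu>' \<le> ennreal (M\<^sub>2 * h\<^sup>2)"
  shows "\<forall>(m::nat) \<nu>. borel_prob \<nu> \<longrightarrow>
    ennreal (TV \<mu>' (\<nu> \<bind> kernel_power (uhmc_kernel U T h) (m + 1)))
      \<le> ennreal (3 / 2 * sqrt (1 / T\<^sup>2 + 27 * real CARD('n) * L\<^sub>H\<^sup>2 * T ^ 4) * M\<^sub>1)
         * W1 \<mu>' \<nu> * ennreal (exp (- c * real m))"
proof (intro allI impI)
  fix m :: nat and \<nu> :: "(real^'n) measure" assume \<nu>: "borel_prob \<nu>"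
  note T = \<open>T > 0\<close> and h = \<open>h > 0\<close>
  obtain n where "T / h = real n" using \<open>T / h \<in> \<nat>\<close> by (auto elim: Nats_cases)
  then have T_eq: "T = real n * h" using h by (simp add: field_simps)
  have "norm (D2 U 0) \<le> L"
    unfolding \<open>L = _\<close> by (rule cSUP_upper) (use assms(5) in auto)
  then have L: "0 \<le> L" using norm_ge_zero order_trans by blast
  have "L * T\<^sup>2 \<le> L * (T\<^sup>2 + T * h)" using L T h by (intro mult_left_mono) auto
  then have LT: "L * T\<^sup>2 \<le> 1 / 6" using assms(14) by linarith
  have vs: "verlet_smooth U (\<lambda>x u. riesz (blinfun_apply (D2 U x) u)) L L\<^sub>H h T n"
    using verlet_smoothI[OF assms(1,5,7) T h T_eq] LT assms(6,8) by simp
  define K where "K = uhmc_kernel U T h"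
  have K: "K \<in> borel \<rightarrow>\<^sub>M prob_algebra borel"
    unfolding K_def by (rule verlet_smooth.uhmc_kernel_measurable[OF vs])
  define C where "C = 3 / 2 * sqrt (1 / T\<^sup>2 + 27 * real CARD('n) * L\<^sub>H\<^sup>2 * T ^ 4)"
  have C: "C > 0" using T by (simp add: C_def add_pos_nonneg)
  define \<nu>' where "\<nu>' = \<nu> \<bind> kernel_power K m"
  have \<nu>': "borel_prob \<nu>'"
    unfolding \<nu>'_def by (rule borel_prob_bind[OF \<nu> kernel_power_measurable[OF K]])
  \<comment> \<open>The first \<open>m\<close> transitions contract the Wasserstein distance, and
    the last one turns it into total variation; invariance lets the same last transition act on
    \<mu>'.\<close>
  have "\<nu> \<bind> kernel_power K (m + 1) = \<nu>' \<bind> K"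
    unfolding \<nu>'_def using bind_kernel_power_Suc[OF _ K] \<nu> by (simp add: borel_prob_def)
  moreover have "\<mu>' \<bind> K = \<mu>'" using assms(16) by (simp add: K_def)
  ultimately have "ennreal (TV \<mu>' (\<nu> \<bind> kernel_power K (m + 1))) = ennreal (TV (\<mu>' \<bind> K) (\<nu>' \<bind> K))"
    by simp
  also have "\<dots> \<le> ennreal C * W1 \<mu>' \<nu>'"
    using uhmc_kernel_dist_le[OF vs] by (intro TV_bind_le_W1[OF K C _ assms(15) \<nu>']) (simp add: K_def C_def)
  also have "\<dots> \<le> ennreal C * (ennreal (M\<^sub>1 * exp (- c * real m)) * W1 \<mu>' \<nu>)"
    using A5[rule_format, OF \<nu>, of m] W1_commute[of \<mu>' \<nu>] W1_commute[of \<mu>' \<nu>']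
    by (intro mult_left_mono) (simp_all add: \<nu>'_def K_def)
  also have "\<dots> = ennreal (C * M\<^sub>1) * W1 \<mu>' \<nu> * ennreal (exp (- c * real m))"
    using C \<open>M\<^sub>1 > 0\<close> by (simp add: ennreal_mult mult_ac)
  finally show "ennreal (TV \<mu>' (\<nu> \<bind> kernel_power (uhmc_kernel U T h) (m + 1)))
      \<le> ennreal (3 / 2 * sqrt (1 / T\<^sup>2 + 27 * real CARD('n) * L\<^sub>H\<^sup>2 * T ^ 4) * M\<^sub>1)
         * W1 \<mu>' \<nu> * ennreal (exp (- c * real m))"
    by (simp add: K_def C_def)
qed

end
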